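(* In the setting described in the context, if there exists an $A_n$–$B_m$–coherent trail for some $n,m\in\mathbb N$, then there also exists an $A_0$–$B_0$–coherent trail.
   Context: All graphs are finite and simple; $[n]=\{1,\dots,n\}$, $[0,n]=\{0,\dots,n\}$, $\mathbb N=\{0,1,2,\dots\}$. A trail is a walk $q_0\dots q_w$ with distinct edges; a circuit is a closed trail. Setting: $G=(V,E)$ is a 2-edge-connected graph, $k\ge1$, $e_1,\dots,e_{k+1}$ are edges of $G$, $e_{k+1}=ab$, and $H$ is a shortest circuit in $G$ containing $e_1,\dots,e_k$, labelled in traversal order so that $H=H_1e_1H_2e_2\dots e_{k-1}H_ke_k$ with segments $H_1,\dots,H_k$; each $H_j$ is a path and $<_j$ is the order in which $H$ traverses $V(H_j)$. Subtrail: a trail $P=p_0\dots p_r$ is a subtrail of $Q=q_0\dots q_w$ with witnessing interval $I_P=\{t,\dots,t+r\}\subseteq[0,w]$ if $p_h=q_{t+h}$ for all $h\in[0,r]$, or $p_h=q_{t+r-h}$ for all $h\in[0,r]$ (the empty trail is a subtrail with empty witnessing interval). For $U\subseteq V$, $j\in[k]$: $\mathrm{Ins}_j(U)=U\cap V(H_j)$; $\mathrm{Cl}_j(U)$ is the subpath of $H_j$ from $\min_{<_j}\mathrm{Ins}_j(U)$ to $\max_{<_j}\mathrm{Ins}_j(U)$ (empty if $\mathrm{Ins}_j(U)=\emptyset$); $\mathrm{Cl}(U)=\bigcup_{j}V(\mathrm{Cl}_j(U))$. An $x$–$y$ trail $P$ is admissible if it lies in $G-E(H)-e_{k+1}$ and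 $V(P)\cap V(H)\subseteq\{x,y\}$ (trivial trails allowed). $\mathrm{Reach}(X)=\{y'\in V(H):\exists x'\in X$ with an admissible $x'$–$y'$ trail$\}$. $A_0=\emptyset$, $A_1=\mathrm{Reach}(\{a\})$, $A_{i+1}=\mathrm{Reach}(\mathrm{Cl}(A_i))$ for $i\ge1$; $B_i$ analogously with $b$. For $n,m\in\mathbb N$, a trail $Q=q_0\dots q_w$ is $A_n$–$B_m$–coherent if: (C1) $e_1,\dots,e_k\in E(Q)$, $q_0\in A_{n+1}$ and $q_w\in B_{m+1}$; (C2) for every $s\in[w]$ with $q_{s-1}q_s\in E\setminus E(H)$ there are $r,t\in[0,w]$ with $r<s\le t$, $q_r,q_t\in V(H)$, such that $q_r\dots q_t$ (the part of $Q$ between indices $r$ and $t$) is an admissible $q_r$–$q_t$ trail, and each of $A_{n+1}$ and $B_{m+1}$ contains at most one of $q_r,q_t$; (C3) for every $j\in[k]$, $\mathrm{Cl}_j(A_n)$ and $\mathrm{Cl}_j(B_m)$ are subtrails of $Q$ with witnessing intervals $I_{A_n,j}$ and $I_{B_m,j}$ such that $I_{X,j}\cap I_{Y,j'}=\emptyset$ for all $X,Y\in\{A_n,B_m\}$ and all distinct $j\neq j'$ in $[k]$. *)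

theory Defs
  imports Main
begin

text \<open>
  A finite simple graph is given by a vertex set \<open>V\<close> and a set \<open>E\<close> of two-element subsets of \<open>V\<close>.
  A walk \<open>q\<^sub>0 \<dots> q\<^sub>w\<close> is the nonempty list of its \<open>w + 1\<close> vertices; since graphs are simple, the list
  determines the edges. The empty list is not a walk; it represents the empty trail where needed.
\<close>

definition simple_graph :: "'a set \<Rightarrow> 'a set set \<Rightarrow> bool" where
  "simple_graph V E \<longleftrightarrow> finite V \<and> E \<subseteq> {{u, v} | u v. u \<in> V \<and> v \<in> V \<and> u \<noteq> v}"

definition walk_edges :: "'a list \<Rightarrow> 'a set list" where
  "walk_edges q = map (\<lambda>(u, v). {u, v}) (zip q (tl q))"

abbreviation edges_of :: "'a list \<Rightarrow> 'a set set" where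
  "edges_of q \<equiv> set (walk_edges q)"

definition walk :: "'a set \<Rightarrow> 'a set set \<Rightarrow> 'a list \<Rightarrow> bool" where
  "walk V E q \<longleftrightarrow> q \<noteq> [] \<and> set q \<subseteq> V \<and> edges_of q \<subseteq> E"

definition trail :: "'a set \<Rightarrow> 'a set set \<Rightarrow> 'a list \<Rightarrow> bool" where
  "trail V E q \<longleftrightarrow> walk V E q \<and> distinct (walk_edges q)"

definition circuit :: "'a set \<Rightarrow> 'a set set \<Rightarrow> 'a list \<Rightarrow> bool" where
  "circuit V E q \<longleftrightarrow> trail V E q \<and> hd q = last q"

definition graph_connected :: "'a set \<Rightarrow> 'a set set \<Rightarrow> bool" where
  "graph_connected V E \<longleftrightarrow>
     V \<noteq> {} \<and> (\<forall>u\<in>V. \<forall>v\<in>V. \<exists>p. walk V E p \<and> hd p = u \<and> last p = v)"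

definition edge_connected :: "nat \<Rightarrow> 'a set \<Rightarrow> 'a set set \<Rightarrow> bool" where
  "edge_connected l V E \<longleftrightarrow>
     card V \<ge> 2 \<and> (\<forall>F \<subseteq> E. card F < l \<longrightarrow> graph_connected V (E - F))"

definition shortest_circuit_through ::
    "'a set \<Rightarrow> 'a set set \<Rightarrow> 'a set set \<Rightarrow> 'a list \<Rightarrow> bool" where
  "shortest_circuit_through V E F H \<longleftrightarrow>
     circuit V E H \<and> F \<subseteq> edges_of H \<and>
     (\<forall>C. circuit V E C \<and> F \<subseteq> edges_of C \<longrightarrow> length (walk_edges H) \<le> length (walk_edges C))"

text \<open>
  \<open>H = H\<^sub>1 e\<^sub>1 H\<^sub>2 e\<^sub>2 \<dots> H\<^sub>k e\<^sub>k\<close>: the circuit is based at the first vertex of \<open>H\<^sub>1\<close>, and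
  \<open>e\<^sub>j\<close> joins the last vertex of \<open>H\<^sub>j\<close> to the first vertex of the cyclically next segment.
  That each \<open>H\<^sub>j\<close> is a path is not demanded: it follows when \<open>H\<close> is a shortest circuit
  through \<open>e\<^sub>1, \<dots>, e\<^sub>k\<close>.
\<close>

definition segmentation :: "nat \<Rightarrow> (nat \<Rightarrow> 'a set) \<Rightarrow> (nat \<Rightarrow> 'a list) \<Rightarrow> 'a list \<Rightarrow> bool" where
  "segmentation k e Hs H \<longleftrightarrow>
     (\<forall>j\<in>{1..k}. Hs j \<noteq> []) \<and>
     H = concat (map Hs [1..<Suc k]) @ [hd (Hs 1)] \<and>
     (\<forall>j\<in>{1..k}. e j = {last (Hs j), hd (Hs (if j = k then 1 else Suc j))})"

definition subtrail_at :: "'a list \<Rightarrow> 'a list \<Rightarrow> nat set \<Rightarrow> bool" where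
  "subtrail_at p q I \<longleftrightarrow>
     (p = [] \<and> I = {}) \<or>
     (\<exists>t r. length p = Suc r \<and> t + r < length q \<and> I = {t..t + r} \<and>
        ((\<forall>h\<le>r. p ! h = q ! (t + h)) \<or> (\<forall>h\<le>r. p ! h = q ! (t + r - h))))"

text \<open>
  \<open>cl_seg S U\<close> is \<open>Cl\<^sub>j(U)\<close> for \<open>S = H\<^sub>j\<close>; the order \<open><\<^sub>j\<close> is the order of list positions in \<open>S\<close>.
\<close>

definition cl_seg :: "'a list \<Rightarrow> 'a set \<Rightarrow> 'a list" where
  "cl_seg S U =
     (let Ins = {i. i < length S \<and> S ! i \<in> U}
      in if Ins = {} then [] else take (Suc (Max Ins - Min Ins)) (drop (Min Ins) S))"

definition cl :: "nat \<Rightarrow> (nat \<Rightarrow> 'a list) \<Rightarrow> 'a set \<Rightarrow> 'a set" where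
  "cl k Hs U = (\<Union>j\<in>{1..k}. set (cl_seg (Hs j) U))"

text \<open>In the following, \<open>f\<close> stands for the edge \<open>e\<^sub>k\<^sub>+\<^sub>1\<close>.\<close>

definition admissible ::
    "'a set \<Rightarrow> 'a set set \<Rightarrow> 'a list \<Rightarrow> 'a set \<Rightarrow> 'a \<Rightarrow> 'a \<Rightarrow> 'a list \<Rightarrow> bool" where
  "admissible V E H f x y p \<longleftrightarrow>
     trail V (E - edges_of H - {f}) p \<and> hd p = x \<and> last p = y \<and> set p \<inter> set H \<subseteq> {x, y}"

definition reach :: "'a set \<Rightarrow> 'a set set \<Rightarrow> 'a list \<Rightarrow> 'a set \<Rightarrow> 'a set \<Rightarrow> 'a set" where
  "reach V E H f X = {y \<in> set H. \<exists>x\<in>X. \<exists>p. admissible V E H f x y p}"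

text \<open>\<open>layer \<dots> v i\<close> is \<open>A\<^sub>i\<close> for \<open>v = a\<close> and \<open>B\<^sub>i\<close> for \<open>v = b\<close>.\<close>

fun layer ::
    "'a set \<Rightarrow> 'a set set \<Rightarrow> nat \<Rightarrow> (nat \<Rightarrow> 'a list) \<Rightarrow> 'a list \<Rightarrow> 'a set \<Rightarrow> 'a \<Rightarrow> nat \<Rightarrow> 'a set" where
  "layer V E k Hs H f v 0 = {}"
| "layer V E k Hs H f v (Suc 0) = reach V E H f {v}"
| "layer V E k Hs H f v (Suc (Suc i)) = reach V E H f (cl k Hs (layer V E k Hs H f v (Suc i)))"

definition coherent ::
    "'a set \<Rightarrow> 'a set set \<Rightarrow> nat \<Rightarrow> (nat \<Rightarrow> 'a set) \<Rightarrow> 'a \<Rightarrow> 'a \<Rightarrow> (nat \<Rightarrow> 'a list) \<Rightarrow> 'a list \<Rightarrow>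
     nat \<Rightarrow> nat \<Rightarrow> 'a list \<Rightarrow> bool" where
  "coherent V E k e a b Hs H n m q \<longleftrightarrow>
     (let f = e (Suc k);
          w = length q - 1;
          A = layer V E k Hs H f a;
          B = layer V E k Hs H f b
      in trail V E q \<and>
         (\<forall>i\<in>{1..k}. e i \<in> edges_of q) \<and> q ! 0 \<in> A (n + 1) \<and> q ! w \<in> B (m + 1) \<and>
         (\<forall>s\<in>{1..w}. {q ! (s - 1), q ! s} \<in> E - edges_of H \<longrightarrow>
            (\<exists>r t. r < s \<and> s \<le> t \<and> t \<le> w \<and> q ! r \<in> set H \<and> q ! t \<in> set H \<and>
               admissible V E H f (q ! r) (q ! t) (take (Suc (t - r)) (drop r q)) \<and>
               \<not> (q ! r \<in> A (n + 1) \<and> q ! t \<in> A (n + 1)) \<and>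
               \<not> (q ! r \<in> B (m + 1) \<and> q ! t \<in> B (m + 1)))) \<and>
         (\<exists>IA IB :: nat \<Rightarrow> nat set.
            (\<forall>j\<in>{1..k}. subtrail_at (cl_seg (Hs j) (A n)) q (IA j) \<and>
                        subtrail_at (cl_seg (Hs j) (B m)) q (IB j)) \<and>
            (\<forall>j\<in>{1..k}. \<forall>j'\<in>{1..k}. j \<noteq> j' \<longrightarrow>
               (\<forall>I\<in>{IA, IB}. \<forall>J\<in>{IA, IB}. I j \<inter> J j' = {}))))"

end

theory Submission
  imports Defs "HOL-Library.Sublist"
begin

text \<open>
  The proof is a descent on \<open>n + m\<close>. Let \<open>Q\<close> be \<open>A\<^sub>n\<close>-\<open>B\<^sub>m\<close>-coherent with \<open>n \<ge> 1\<close>.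

  If some segment \<open>H\<^sub>j\<close> meets both \<open>A\<^sub>n\<close> and \<open>B\<^sub>m\<^sub>+\<^sub>1\<close>, take the least \<open>c\<close> and \<open>d\<close> such that \<open>H\<^sub>j\<close>
  meets \<open>A\<^sub>c\<^sub>+\<^sub>1\<close> and \<open>B\<^sub>d\<^sub>+\<^sub>1\<close>. Cutting the circuit \<open>H\<close> open between a vertex of \<open>A\<^sub>c\<^sub>+\<^sub>1\<close> and one of
  \<open>B\<^sub>d\<^sub>+\<^sub>1\<close> on \<open>H\<^sub>j\<close> yields an \<open>A\<^sub>c\<close>-\<open>B\<^sub>d\<close>-coherent trail, since \<open>H\<^sub>j\<close> misses \<open>A\<^sub>c\<close> and \<open>B\<^sub>d\<close>.

  Otherwise \<open>Q\<close> is rotated at its first vertex \<open>q\<^sub>0\<close>, which may be assumed to lie outside \<open>A\<^sub>n\<close>: an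
  admissible path \<open>P\<close> joins \<open>q\<^sub>0\<close> to a vertex \<open>q\<^sub>s\<close> of some \<open>Cl\<^sub>j(A\<^sub>n)\<close>, and it shares no edge with \<open>Q\<close>,
  because both ends of an excursion of \<open>Q\<close> that it touches would lie in \<open>A\<^sub>n\<^sub>+\<^sub>1\<close>. If \<open>q\<^sub>i\<close> is the last
  vertex of \<open>A\<^sub>n\<close> before \<open>q\<^sub>s\<close> on \<open>Cl\<^sub>j(A\<^sub>n)\<close>, then \<open>q\<^sub>i \<dots> q\<^sub>0 P q\<^sub>s \<dots> q\<^sub>w\<close> is \<open>A\<^sub>n\<^sub>-\<^sub>1\<close>-\<open>B\<^sub>m\<close>-coherent.
  The new excursion \<open>P\<close> obeys (C2) because \<open>q\<^sub>0\<close> is not in \<open>A\<^sub>n\<close> and \<open>q\<^sub>s\<close> is not in \<open>B\<^sub>m\<^sub>+\<^sub>1\<close>. No closure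
  is torn apart: those of \<open>A\<^sub>n\<^sub>-\<^sub>1\<close> avoid \<open>q\<^sub>s\<close>, those of \<open>B\<^sub>m\<close> avoid \<open>q\<^sub>i\<close>, and their ends are not among
  the vertices after \<open>q\<^sub>i\<close> up to \<open>q\<^sub>s\<close>. The case \<open>m \<ge> 1\<close> is symmetric under reversal.
\<close>

subsection \<open>Joining vertex lists\<close>

lemma sublist_append_last_notin:
  assumes "sublist c (xs @ ys)" and "c \<noteq> [] \<Longrightarrow> last c \<notin> set ys"
  shows "sublist c xs"
proof -
  consider "sublist c xs" | "sublist c ys"
    | c1 c2 where "c = c1 @ c2" "suffix c1 xs" "prefix c2 ys"
    using assms(1) unfolding sublist_append by blast
  then show ?thesis
  proof cases
    case 2
    then have "c = []" using assms(2) set_mono_sublist[of c ys] last_in_set[of c] by blast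
    then show ?thesis by simp
  next
    case 3
    have "c2 = []"
    proof (rule ccontr)
      assume "c2 \<noteq> []"
      then have "last c \<in> set ys" using 3 set_mono_prefix[of c2 ys] last_in_set[of c2] by auto
      then show False using assms(2) 3(1) \<open>c2 \<noteq> []\<close> by simp
    qed
    then show ?thesis using 3 by (simp add: suffix_imp_sublist)
  qed
qed

lemma sublist_append_hd_notin:
  assumes "sublist c (xs @ ys)" and "c \<noteq> [] \<Longrightarrow> hd c \<notin> set xs"
  shows "sublist c ys"
  using sublist_append_last_notin[of "rev c" "rev ys" "rev xs"] assms
  by (simp add: last_rev sublist_rev flip: rev_append)

lemma sublist_append_disjoint:
  assumes "sublist c (xs @ ys @ zs)" and "ys \<noteq> []" and "set c \<inter> set ys = {}"
  shows "sublist c xs \<or> sublist c zs"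
proof -
  consider "sublist c xs" | "sublist c (ys @ zs)"
    | c1 c2 where "c = c1 @ c2" "suffix c1 xs" "prefix c2 (ys @ zs)"
    using assms(1) unfolding sublist_append[of c xs] by blast
  then show ?thesis
  proof cases
    case 2
    moreover have "hd c \<notin> set ys" if "c \<noteq> []" using hd_in_set[OF that] assms(3) by blast
    ultimately show ?thesis using sublist_append_hd_notin by blast
  next
    case 3
    have "c2 = []"
    proof (rule ccontr)
      assume "c2 \<noteq> []"
      then have "hd c2 = hd ys" using 3(3) assms(2) by (metis hd_append prefix_def)
      then show False using \<open>c2 \<noteq> []\<close> 3(1) assms(2,3) hd_in_set[of c2] hd_in_set[of ys] by auto
    qed
    then show ?thesis using 3 by (simp add: suffix_imp_sublist)
  qed simp
qed

definition join :: "'a list \<Rightarrow> 'a list \<Rightarrow> 'a list" (infixr "\<bowtie>" 65) where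
  "xs \<bowtie> ys = xs @ tl ys"

definition joinable :: "'a list \<Rightarrow> 'a list \<Rightarrow> bool" where
  "joinable xs ys \<longleftrightarrow> xs \<noteq> [] \<and> ys \<noteq> [] \<and> last xs = hd ys"

lemma joinableE:
  assumes "joinable xs ys"
  obtains xs' u ys' where "xs = xs' @ [u]" "ys = u # ys'"
proof (rule that)
  show "xs = butlast xs @ [last xs]"
    using assms unfolding joinable_def by (intro append_butlast_last_id[symmetric]) blast
  show "ys = last xs # tl ys" using assms unfolding joinable_def by simp
qed

lemma joinableD:
  assumes "joinable xs ys"
  shows "xs \<noteq> []" "ys \<noteq> []" "last xs = hd ys"
  using assms by (simp_all add: joinable_def)

lemma hd_join [simp]: "xs \<noteq> [] \<Longrightarrow> hd (xs \<bowtie> ys) = hd xs"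
  by (simp add: join_def)

lemma last_join [simp]: "joinable xs ys \<Longrightarrow> last (xs \<bowtie> ys) = last ys"
  by (erule joinableE) (simp add: join_def)

lemma set_join [simp]: "joinable xs ys \<Longrightarrow> set (xs \<bowtie> ys) = set xs \<union> set ys"
  by (erule joinableE) (auto simp: join_def)

lemma join_assoc: "joinable xs ys \<Longrightarrow> (xs \<bowtie> ys) \<bowtie> zs = xs \<bowtie> ys \<bowtie> zs"
  by (simp add: join_def joinable_def)

lemma rev_join: "joinable xs ys \<Longrightarrow> rev (xs \<bowtie> ys) = rev ys \<bowtie> rev xs"
  by (erule joinableE) (simp add: join_def)

lemma joinable_rev [simp]: "joinable (rev xs) (rev ys) \<longleftrightarrow> joinable ys xs"
  by (auto simp: joinable_def hd_rev last_rev)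

lemma joinable_join_left [simp]: "joinable xs ys \<Longrightarrow> joinable (xs \<bowtie> ys) zs \<longleftrightarrow> joinable ys zs"
  by (simp add: joinable_def[of _ zs]) (auto dest: joinableD simp: join_def)

lemma joinable_join_right [simp]: "joinable ys zs \<Longrightarrow> joinable xs (ys \<bowtie> zs) \<longleftrightarrow> joinable xs ys"
  by (simp add: joinable_def join_def)

lemma sublist_join_left: "sublist xs (xs \<bowtie> ys)"
  by (simp add: join_def)

lemma sublist_join_right: "joinable xs ys \<Longrightarrow> sublist ys (xs \<bowtie> ys)"
  by (erule joinableE) (auto simp: join_def sublist_append)

lemma sublist_join_rightmost: "joinable xs ys \<Longrightarrow> joinable ys zs \<Longrightarrow> sublist zs (xs \<bowtie> ys \<bowtie> zs)"
  using sublist_order.order_trans[OF sublist_join_right[of ys zs]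
      sublist_join_right[of xs "ys \<bowtie> zs"]] by simp

lemma split_joinable:
  assumes "x \<in> set q"
  obtains xs ys where "q = xs \<bowtie> ys" "joinable xs ys" "last xs = x"
proof -
  obtain xs ys where "q = xs @ x # ys" using split_list[OF assms] by blast
  then show thesis using that[of "xs @ [x]" "x # ys"] by (simp add: join_def joinable_def)
qed

lemma split_at_two_vertices:
  assumes "x \<in> set q" "y \<in> set q"
  obtains xs p zs where "q = xs \<bowtie> p \<bowtie> zs" "joinable xs p" "joinable p zs"
    "hd p = x \<and> last p = y \<or> hd p = y \<and> last p = x"
proof -
  obtain xs ys where q: "q = xs \<bowtie> ys" "joinable xs ys" "last xs = x"
    using split_joinable[OF assms(1)] .
  then consider "y \<in> set xs" | "y \<in> set ys" using assms(2) by auto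
  then show thesis
  proof cases
    case 1
    then obtain xs' p where "xs = xs' \<bowtie> p" "joinable xs' p" "last xs' = y"
      by (rule split_joinable)
    moreover from this have "joinable p ys" using q(1,2) by simp
    ultimately show thesis using q that[of xs' p ys] joinableD(3) by (metis join_assoc last_join)
  next
    case 2
    then obtain p zs where "ys = p \<bowtie> zs" "joinable p zs" "last p = y"
      by (rule split_joinable)
    moreover from this have "joinable xs p" using q(2) by simp
    ultimately show thesis using q that[of xs p zs] joinableD(3) by metis
  qed
qed

definition interior :: "'a list \<Rightarrow> 'a list" where
  "interior p = butlast (tl p)"

lemma interior_Cons_snoc [simp]: "interior (u # ys @ [v]) = ys"
  by (simp add: interior_def)

lemma interior_rev [simp]: "interior (rev p) = rev (interior p)"
  by (cases p rule: rev_cases) (simp_all add: interior_def butlast_rev butlast_tl)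

lemma set_interior_subset: "set (interior p) \<subseteq> set p"
  unfolding interior_def by (cases p) (auto dest: in_set_butlastD)

lemma sublist_join_cases:
  assumes "sublist p (xs \<bowtie> ys)" and "joinable xs ys"
  obtains "sublist p xs" | "sublist p ys" | "hd ys \<in> set (interior p)"
proof -
  obtain xs' u ys' where xs: "xs = xs' @ [u]" and ys: "ys = u # ys'"
    using assms(2) by (rule joinableE)
  have "sublist p (xs @ ys')" using assms(1) by (simp add: join_def ys)
  then consider "sublist p xs" | "sublist p ys'"
    | p1 p2 where "p = p1 @ p2" "suffix p1 (xs' @ [u])" "prefix p2 ys'"
    unfolding sublist_append xs by blast
  then show thesis
  proof cases
    case 2
    then show ?thesis using that(2) ys by (simp add: sublist_Cons_right)
  next
    case 3
    show ?thesis
    proof (cases "p1 = [] \<or> p2 = []")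
      case True
      then show ?thesis using 3 that(1,2) ys xs
        by (auto simp: sublist_Cons_right suffix_imp_sublist prefix_imp_sublist)
    next
      case False
      then obtain p1' where p1: "p1 = p1' @ [u]"
        using 3(2) by (auto simp: suffix_snoc)
      show ?thesis
      proof (cases p1')
        case Nil
        then show ?thesis using 3 p1 ys that(2) by (simp add: sublist_Cons_right)
      next
        case (Cons w ws)
        then show ?thesis using 3(1) p1 False that(3) ys
          by (simp add: interior_def butlast_append)
      qed
    qed
  qed (use that in blast)
qed

subsection \<open>Walks and trails\<close>

lemma walk_edges_simps [simp]:
  "walk_edges [] = []" "walk_edges [x] = []"
  "walk_edges (x # y # zs) = {x, y} # walk_edges (y # zs)"
  by (simp_all add: walk_edges_def)

lemma walk_edges_append:
  "xs \<noteq> [] \<Longrightarrow> ys \<noteq> [] \<Longrightarrow>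
   walk_edges (xs @ ys) = walk_edges xs @ {last xs, hd ys} # walk_edges ys"
proof (induction xs rule: induct_list012)
  case (2 x)
  then show ?case by (cases ys) simp_all
qed simp_all

lemma walk_edges_join [simp]:
  assumes "joinable xs ys"
  shows "walk_edges (xs \<bowtie> ys) = walk_edges xs @ walk_edges ys"
proof -
  obtain xs' u ys' where "xs = xs' @ [u]" "ys = u # ys'" using assms by (rule joinableE)
  then show ?thesis
    using walk_edges_append[of "xs' @ [u]" ys'] by (cases ys') (simp_all add: join_def)
qed

lemma walk_edges_rev [simp]: "walk_edges (rev q) = rev (walk_edges q)"
proof (induction q rule: induct_list012)
  case (3 x y zs)
  then show ?case using walk_edges_append[of "rev zs @ [y]" "[x]"] by (simp add: insert_commute)
qed simp_all

lemma sublist_walk_edges: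
  assumes "sublist p q"
  shows "sublist (walk_edges p) (walk_edges q)"
proof -
  have right: "sublist (walk_edges xs) (walk_edges (xs @ ys))" for xs ys :: "'a list"
    by (cases "xs = [] \<or> ys = []") (auto simp: walk_edges_append)
  have left: "sublist (walk_edges ys) (walk_edges (xs @ ys))" for xs ys :: "'a list"
    using right[of "rev ys" "rev xs"] by (simp flip: rev_append)
  obtain xs ys where "q = xs @ p @ ys" using assms by (auto simp: sublist_def)
  then show ?thesis using sublist_order.order_trans[OF right left] by metis
qed

lemma edges_of_sublist: "sublist p q \<Longrightarrow> edges_of p \<subseteq> edges_of q"
  by (intro set_mono_sublist sublist_walk_edges)

lemma edges_of_split:
  assumes "g \<in> edges_of q"
  obtains xs ys where "q = xs @ ys" "xs \<noteq> []" "ys \<noteq> []" "g = {last xs, hd ys}"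
  using assms
proof (induction q arbitrary: thesis rule: induct_list012)
  case (3 x y zs)
  consider "g = {x, y}" | "g \<in> edges_of (y # zs)" using "3.prems"(2) by auto
  then show ?case
  proof cases
    case 1
    then show ?thesis using "3.prems"(1)[of "[x]" "y # zs"] by simp
  next
    case 2
    then obtain xs ys where "y # zs = xs @ ys" "xs \<noteq> []" "ys \<noteq> []" "g = {last xs, hd ys}"
      using "3.IH"(2) by metis
    then show ?thesis using "3.prems"(1)[of "x # xs" ys] by simp
  qed
qed simp_all

lemma edge_subset_vertices: "g \<in> edges_of q \<Longrightarrow> g \<subseteq> set q"
  by (elim edges_of_split) auto

lemma edge_meets_interior:
  assumes "g \<in> edges_of p" and "interior p \<noteq> []"
  shows "g \<inter> set (interior p) \<noteq> {}"
proof -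
  obtain xs ys where p: "p = xs @ ys" "xs \<noteq> []" "ys \<noteq> []" "g = {last xs, hd ys}"
    using assms(1) by (rule edges_of_split)
  show ?thesis
  proof (cases "tl xs = []")
    case True
    then have "interior p = butlast ys" using p by (cases xs) (simp_all add: interior_def)
    then have "hd ys \<in> set (interior p)" using assms(2) p(3) by (cases ys) auto
    then show ?thesis using p(4) by blast
  next
    case False
    then have "interior p = tl xs @ butlast ys"
      using p by (simp add: interior_def butlast_append)
    moreover have "last xs \<in> set (tl xs)" using False last_in_set last_tl by metis
    ultimately show ?thesis using p(4) by auto
  qed
qed

lemma distinct_walk_edges: "distinct q \<Longrightarrow> distinct (walk_edges q)"
proof (induction q rule: induct_list012)
  case (3 x y zs)
  then show ?case using edge_subset_vertices[of "{x, y}" "y # zs"] by auto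
qed simp_all

lemma walk_sublist: "walk V E q \<Longrightarrow> sublist p q \<Longrightarrow> p \<noteq> [] \<Longrightarrow> walk V E p"
  unfolding walk_def using set_mono_sublist edges_of_sublist by blast

lemma walk_rev [simp]: "walk V E (rev q) \<longleftrightarrow> walk V E q"
  by (simp add: walk_def)

lemma walk_join_iff:
  "joinable p q \<Longrightarrow> walk V E (p \<bowtie> q) \<longleftrightarrow> walk V E p \<and> walk V E q"
  using walk_edges_join[of p q] set_join[of p q] by (auto simp: walk_def join_def dest: joinableD)

lemma trail_sublist: "trail V E q \<Longrightarrow> sublist p q \<Longrightarrow> p \<noteq> [] \<Longrightarrow> trail V E p"
  unfolding trail_def using walk_sublist sublist_walk_edges[of p q]
  by (metis distinct_append sublist_def)

lemma trail_rev [simp]: "trail V E (rev q) \<longleftrightarrow> trail V E q"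
  by (simp add: trail_def)

lemma trail_join_iff:
  "joinable p q \<Longrightarrow>
   trail V E (p \<bowtie> q) \<longleftrightarrow> trail V E p \<and> trail V E q \<and> edges_of p \<inter> edges_of q = {}"
  by (auto simp: trail_def walk_join_iff)

lemma walk_to_path:
  assumes "walk V E q"
  obtains p where "walk V E p" "distinct p" "hd p = hd q" "last p = last q" "set p \<subseteq> set q"
  using assms
proof (induction "length q" arbitrary: q thesis rule: less_induct)
  case less
  show ?case
  proof (cases "distinct q")
    case False
    then obtain xs ys zs y where q: "q = (xs @ [y]) \<bowtie> (y # ys @ [y]) \<bowtie> (y # zs)"
      using not_distinct_decomp[of q] by (auto simp: join_def)
    have join: "joinable (xs @ [y]) (y # zs)" "joinable (xs @ [y]) (y # ys @ [y])"
      "joinable (y # ys @ [y]) (y # zs)"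
      by (simp_all add: joinable_def)
    let ?r = "(xs @ [y]) \<bowtie> (y # zs)"
    have "walk V E ?r" using less.prems(2) join unfolding q by (simp add: walk_join_iff)
    moreover have "length ?r < length q" by (simp add: q join_def)
    ultimately obtain p where "walk V E p" "distinct p" "hd p = hd ?r" "last p = last ?r"
      "set p \<subseteq> set ?r"
      using less.hyps by blast
    moreover have "hd ?r = hd q" "last ?r = last q" "set ?r \<subseteq> set q"
      using join by (auto simp: q)
    ultimately show ?thesis using less.prems(1)[of p] by auto
  qed (use less.prems in blast)
qed

subsection \<open>Traversed paths\<close>

definition traverses :: "'a list \<Rightarrow> 'a list \<Rightarrow> bool" where
  "traverses q p \<longleftrightarrow> sublist p q \<or> sublist (rev p) q"

lemma traverses_Nil [simp]: "traverses q []"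
  by (simp add: traverses_def)

lemma traverses_rev [simp]: "traverses (rev q) p \<longleftrightarrow> traverses q p"
  by (auto simp: traverses_def sublist_rev_right)

lemma traverses_sublist: "traverses q p \<Longrightarrow> sublist q q' \<Longrightarrow> traverses q' p"
  unfolding traverses_def using sublist_order.order_trans by blast

lemma sublist_traverses: "traverses q p \<Longrightarrow> sublist p' p \<Longrightarrow> traverses q p'"
  unfolding traverses_def using sublist_order.order_trans sublist_rev by blast

lemma traverses_join:
  assumes "traverses xs c \<or> traverses ys c" and "joinable xs ys"
  shows "traverses (xs \<bowtie> ys) c"
  using assms traverses_sublist sublist_join_left sublist_join_right by blast

lemma subtrail_at_imp_traverses:
  assumes "subtrail_at p q I"
  shows "traverses q p"
proof (cases "p = []")
  case False
  then obtain t r where len: "length p = Suc r" "t + r < length q"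
    and p: "(\<forall>h\<le>r. p ! h = q ! (t + h)) \<or> (\<forall>h\<le>r. p ! h = q ! (t + r - h))"
    using assms by (auto simp: subtrail_at_def)
  have slice: "sublist (take (Suc r) (drop t q)) q"
    using sublist_order.order_trans[OF sublist_take sublist_drop] .
  from p show ?thesis
  proof
    assume "\<forall>h\<le>r. p ! h = q ! (t + h)"
    then have "p = take (Suc r) (drop t q)" using len by (intro nth_equalityI) auto
    then show ?thesis using slice by (simp add: traverses_def)
  next
    assume "\<forall>h\<le>r. p ! h = q ! (t + r - h)"
    then have "rev p = take (Suc r) (drop t q)"
      using len by (intro nth_equalityI) (auto simp: rev_nth)
    then show ?thesis using slice by (simp add: traverses_def)
  qed
qed simp

lemma sublist_cut_last:
  assumes "sublist c (xs \<bowtie> mid \<bowtie> zs)" and "joinable xs mid" and "joinable mid zs"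
    and "last mid \<notin> set c" and "c \<noteq> [] \<Longrightarrow> last c \<notin> set (tl mid)"
  shows "sublist c xs \<or> sublist c zs"
proof -
  have "sublist c ((xs \<bowtie> mid) \<bowtie> zs)"
    using assms(1,2) by (simp add: join_assoc)
  moreover have "joinable (xs \<bowtie> mid) zs" using assms(2,3) by simp
  ultimately consider "sublist c (xs \<bowtie> mid)" | "sublist c zs" | "hd zs \<in> set (interior c)"
    by (rule sublist_join_cases)
  then show ?thesis
  proof cases
    case 1
    then show ?thesis using sublist_append_last_notin[OF _ assms(5)] by (simp add: join_def)
  next
    case 3
    then show ?thesis using assms(4) joinableD(3)[OF assms(3)] set_interior_subset[of c] by auto
  qed simp
qed

lemma traverses_cut_last:
  assumes "traverses (xs \<bowtie> mid \<bowtie> zs) c" and "joinable xs mid" and "joinable mid zs"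
    and "last mid \<notin> set c" and "c \<noteq> [] \<Longrightarrow> {hd c, last c} \<inter> set (tl mid) = {}"
  shows "traverses xs c \<or> traverses zs c"
proof -
  consider "sublist c (xs \<bowtie> mid \<bowtie> zs)" | "sublist (rev c) (xs \<bowtie> mid \<bowtie> zs)"
    using assms(1) unfolding traverses_def by blast
  then show ?thesis
  proof cases
    case 1
    then have "sublist c xs \<or> sublist c zs" using assms(2-5) by (intro sublist_cut_last) auto
    then show ?thesis by (auto simp: traverses_def)
  next
    case 2
    then have "sublist (rev c) xs \<or> sublist (rev c) zs"
      using assms(2-5) by (intro sublist_cut_last) (auto simp: last_rev)
    then show ?thesis by (auto simp: traverses_def)
  qed
qed

lemma traverses_cut_hd:
  assumes "traverses (xs \<bowtie> mid \<bowtie> zs) c" and "joinable xs mid" and "joinable mid zs"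
    and "hd mid \<notin> set c" and "c \<noteq> [] \<Longrightarrow> {hd c, last c} \<inter> set (butlast mid) = {}"
  shows "traverses xs c \<or> traverses zs c"
proof -
  have "rev (xs \<bowtie> mid \<bowtie> zs) = rev zs \<bowtie> rev mid \<bowtie> rev xs"
    using assms(2,3) by (simp add: rev_join join_assoc)
  then have "traverses (rev zs \<bowtie> rev mid \<bowtie> rev xs) c"
    using assms(1) by (metis traverses_rev)
  moreover have "tl (rev mid) = rev (butlast mid)"
    using butlast_rev[of "rev mid"] by (metis rev_rev_ident)
  ultimately have "traverses (rev zs) c \<or> traverses (rev xs) c"
    using assms(2-5) joinableD(1)[OF assms(3)] by (intro traverses_cut_last) (auto simp: last_rev)
  then show ?thesis by auto
qed

lemma traverses_cut_interior:
  assumes "traverses (xs \<bowtie> mid \<bowtie> zs) c" and "joinable mid zs"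
    and "interior mid \<noteq> []" and "set c \<inter> set (interior mid) = {}"
  shows "traverses xs c \<or> traverses zs c"
proof -
  obtain m u zs' where "mid = m @ [u]" "zs = u # zs'" using assms(2) by (rule joinableE)
  then have "xs \<bowtie> mid \<bowtie> zs = xs @ interior mid @ zs"
    using assms(3) by (cases m) (simp_all add: join_def interior_def)
  then show ?thesis
    using assms sublist_append_disjoint[of c xs "interior mid" zs]
      sublist_append_disjoint[of "rev c" xs "interior mid" zs]
    by (auto simp: traverses_def)
qed

lemma traverses_cut_at_last:
  assumes "traverses q p" and "x \<in> set p" and "{hd p, last p} \<subseteq> X"
  obtains xs mid zs where "q = xs \<bowtie> mid \<bowtie> zs" "joinable xs mid" "joinable mid zs"
    "hd mid \<in> X" "last mid = x" "set (tl mid) \<inter> X = {}"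
    "set mid \<subseteq> set p" "edges_of mid \<subseteq> edges_of p"
proof -
  obtain p' where p': "p' = p \<or> p' = rev p" "sublist p' q"
    using assms(1) unfolding traverses_def by metis
  have "x \<in> set p'" "hd p' \<in> X" using p'(1) assms(2,3) by (auto simp: hd_rev)
  then obtain p1 p2 where p12: "p' = p1 @ x # p2" by (meson split_list)
  then have "hd p' \<in> set (p1 @ [x])" by (cases p1) simp_all
  then obtain p0 u ms where u: "p1 @ [x] = p0 @ u # ms" "u \<in> X" "\<forall>y\<in>set ms. y \<notin> X"
    using split_list_last_prop[of "p1 @ [x]" "\<lambda>y. y \<in> X"] \<open>hd p' \<in> X\<close> by blast
  obtain ls rs where q: "q = ls @ p' @ rs" using p'(2) by (auto simp: sublist_def)
  have last: "last (u # ms) = x" using arg_cong[OF u(1), of last] by simp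
  have p'_eq: "p' = p0 @ (u # ms) @ p2" using p12 u(1) by simp
  have sub: "sublist (u # ms) p'" unfolding p'_eq by (meson sublist_appendI)
  show thesis
  proof
    show "q = (ls @ p0 @ [u]) \<bowtie> (u # ms) \<bowtie> (x # p2 @ rs)" by (simp add: q p'_eq join_def)
    show "set (u # ms) \<subseteq> set p" using set_mono_sublist[OF sub] p'(1) by auto
    show "edges_of (u # ms) \<subseteq> edges_of p" using edges_of_sublist[OF sub] p'(1) by auto
  qed (use u last in \<open>auto simp: joinable_def\<close>)
qed

subsection \<open>Closures in a segment\<close>

lemma cl_seg_split:
  obtains xs zs where "S = xs @ cl_seg S U @ zs" "U \<inter> set xs = {}" "U \<inter> set zs = {}"
    "cl_seg S U \<noteq> [] \<Longrightarrow> hd (cl_seg S U) \<in> U \<and> last (cl_seg S U) \<in> U"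
proof -
  let ?I = "{i. i < length S \<and> S ! i \<in> U}"
  show thesis
  proof (cases "?I = {}")
    case True
    then have "cl_seg S U = []" "U \<inter> set S = {}" by (auto simp: cl_seg_def in_set_conv_nth)
    then show thesis using that[of "[]" S] by simp
  next
    case False
    define i j where "i = Min ?I" and "j = Max ?I"
    have ij: "i \<in> ?I" "j \<in> ?I" unfolding i_def j_def using False by (intro Min_in Max_in; simp)+
    have bounds: "i \<le> h \<and> h \<le> j" if "h \<in> ?I" for h
      unfolding i_def j_def using that by (intro conjI Min_le Max_ge) simp_all
    then have le: "i \<le> j" using ij by blast
    have "cl_seg S U = take (Suc (j - i)) (drop i S)"
      unfolding cl_seg_def Let_def i_def j_def using False by (rule if_not_P)
    then have cl: "cl_seg S U = take (Suc j - i) (drop i S)" using le by (simp add: Suc_diff_le)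
    show thesis
    proof
      show "S = take i S @ cl_seg S U @ drop (Suc j) S"
        using le append_take_drop_id[of i S] append_take_drop_id[of "Suc j - i" "drop i S"]
        unfolding cl by (simp del: append_take_drop_id)
      show "U \<inter> set (take i S) = {}" using bounds by (fastforce simp: in_set_conv_nth)
      show "U \<inter> set (drop (Suc j) S) = {}"
      proof (rule ccontr)
        assume "U \<inter> set (drop (Suc j) S) \<noteq> {}"
        then obtain h where "Suc j + h < length S" "S ! (Suc j + h) \<in> U"
          by (auto simp: in_set_conv_nth less_diff_conv add.commute)
        then show False using bounds[of "Suc j + h"] by simp
      qed
      show "hd (cl_seg S U) \<in> U \<and> last (cl_seg S U) \<in> U"
        using ij le by (auto simp: cl hd_drop_conv_nth take_Suc_conv_app_nth Suc_diff_le)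
    qed
  qed
qed

lemma sublist_cl_seg: "sublist (cl_seg S U) S"
  by (rule cl_seg_split[of S U]) (metis sublist_appendI)

lemma set_cl_seg_subset: "set (cl_seg S U) \<subseteq> set S"
  by (rule set_mono_sublist[OF sublist_cl_seg])

lemma Int_subset_cl_seg: "U \<inter> set S \<subseteq> set (cl_seg S U)"
proof (rule cl_seg_split[of S U])
  fix xs zs assume "S = xs @ cl_seg S U @ zs" "U \<inter> set xs = {}" "U \<inter> set zs = {}"
  moreover from this(1) have "set S = set xs \<union> set (cl_seg S U) \<union> set zs"
    by (metis set_append sup_assoc)
  ultimately show ?thesis by blast
qed

lemma cl_seg_ends:
  assumes "cl_seg S U \<noteq> []"
  shows "{hd (cl_seg S U), last (cl_seg S U)} \<subseteq> U \<inter> set S"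
proof (rule cl_seg_split[of S U])
  assume "cl_seg S U \<noteq> [] \<Longrightarrow> hd (cl_seg S U) \<in> U \<and> last (cl_seg S U) \<in> U"
  then show ?thesis using assms set_cl_seg_subset[of S U] by auto
qed

lemma cl_seg_eq_Nil_iff: "cl_seg S U = [] \<longleftrightarrow> U \<inter> set S = {}"
  using cl_seg_ends[of S U] Int_subset_cl_seg[of U S] by auto

lemma sublist_cl_seg_mono:
  assumes "U \<subseteq> U'"
  shows "sublist (cl_seg S U) (cl_seg S U')"
proof (rule cl_seg_split[of S U'])
  fix xs zs
  assume S: "S = xs @ cl_seg S U' @ zs" and "U' \<inter> set xs = {}" "U' \<inter> set zs = {}"
  then have out: "x \<notin> set xs" "x \<notin> set zs" if "x \<in> U" for x using that assms by auto
  have "sublist (cl_seg S U) (xs @ cl_seg S U' @ zs)" using sublist_cl_seg S by metis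
  then have "sublist (cl_seg S U) (cl_seg S U' @ zs)"
    using sublist_append_hd_notin out(1) cl_seg_ends[of S U] by blast
  then show ?thesis using sublist_append_last_notin out(2) cl_seg_ends[of S U] by blast
qed

lemma traverses_cl_seg_cut_last:
  assumes "traverses (xs \<bowtie> mid \<bowtie> zs) (cl_seg S U)" and "joinable xs mid" "joinable mid zs"
    and "last mid \<notin> set (cl_seg S U)" and "U \<inter> set (tl mid) = {}"
  shows "traverses xs (cl_seg S U) \<or> traverses zs (cl_seg S U)"
  using assms(1-4)
proof (rule traverses_cut_last)
  assume "cl_seg S U \<noteq> []"
  then show "{hd (cl_seg S U), last (cl_seg S U)} \<inter> set (tl mid) = {}"
    using cl_seg_ends assms(5) by blast
qed

lemma traverses_cl_seg_cut_hd:
  assumes "traverses (xs \<bowtie> mid \<bowtie> zs) (cl_seg S U)" and "joinable xs mid" "joinable mid zs"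
    and "hd mid \<notin> set (cl_seg S U)" and "U \<inter> set (butlast mid) = {}"
  shows "traverses xs (cl_seg S U) \<or> traverses zs (cl_seg S U)"
  using assms(1-4)
proof (rule traverses_cut_hd)
  assume "cl_seg S U \<noteq> []"
  then show "{hd (cl_seg S U), last (cl_seg S U)} \<inter> set (butlast mid) = {}"
    using cl_seg_ends assms(5) by blast
qed

subsection \<open>Ears\<close>

text \<open>
  An ear is an excursion off \<open>H\<close> that is minimal, so that no cut of a trail at a vertex of \<open>H\<close>
  can split it; the excursions in (C2) need not be minimal.
\<close>

definition ears :: "'a list \<Rightarrow> 'a list \<Rightarrow> 'a list set" where
  "ears H q = {p. sublist p q \<and> hd p \<in> set H \<and> last p \<in> set H \<and>
     set (interior p) \<inter> set H = {} \<and> \<not> edges_of p \<subseteq> edges_of H}"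

lemma ear_shape:
  assumes "p \<in> ears H q"
  obtains u ys v where "p = u # ys @ [v]"
proof -
  have "edges_of p \<noteq> {}" using assms by (auto simp: ears_def)
  then obtain u x xs where "p = u # x # xs" by (cases p rule: remdups_adj.cases) auto
  then show thesis using that[of u "butlast (x # xs)" "last (x # xs)"] by simp
qed

lemma sublist_ear: "p \<in> ears H q \<Longrightarrow> sublist p q"
  by (simp add: ears_def)

lemma ear_ends: "p \<in> ears H q \<Longrightarrow> {hd p, last p} \<subseteq> set H"
  by (simp add: ears_def)

lemma ear_interior: "p \<in> ears H q \<Longrightarrow> set (interior p) \<inter> set H = {}"
  by (simp add: ears_def)

lemma ear_vertices: "p \<in> ears H q \<Longrightarrow> set p = {hd p, last p} \<union> set (interior p)"
  by (erule ear_shape) auto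

lemma ear_edges_disjoint:
  assumes "p \<in> ears H q"
  shows "edges_of p \<inter> edges_of H = {}"
proof (cases "interior p = []")
  case True
  obtain u ys v where "p = u # ys @ [v]" using assms by (rule ear_shape)
  moreover from this have "ys = []" using True by simp
  ultimately show ?thesis using assms by (auto simp: ears_def)
next
  case False
  then show ?thesis
    using edge_meets_interior[of _ p] edge_subset_vertices[of _ H] ear_interior[OF assms] by blast
qed

lemma ears_sublist: "sublist p q \<Longrightarrow> ears H p \<subseteq> ears H q"
  unfolding ears_def using sublist_order.order_trans by blast

lemma ears_rev: "ears H (rev q) = rev ` ears H q"
proof -
  have rev_ear: "rev p \<in> ears H (rev q)" if p: "p \<in> ears H q" for p q
  proof -
    have "p \<noteq> []" using p by (auto elim: ear_shape)
    then show ?thesis using p by (simp add: ears_def hd_rev last_rev)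
  qed
  show ?thesis
  proof
    show "ears H (rev q) \<subseteq> rev ` ears H q"
      using rev_ear[of _ "rev q"] by (metis image_eqI rev_rev_ident subsetI)
    show "rev ` ears H q \<subseteq> ears H (rev q)" using rev_ear by blast
  qed
qed

lemma ears_join:
  assumes "joinable xs ys" and "hd ys \<in> set H"
  shows "ears H (xs \<bowtie> ys) \<subseteq> ears H xs \<union> ears H ys"
proof
  fix p assume p: "p \<in> ears H (xs \<bowtie> ys)"
  then have "hd ys \<notin> set (interior p)" using ear_interior assms(2) by blast
  then have "sublist p xs \<or> sublist p ys"
    using sublist_join_cases[OF sublist_ear[OF p] assms(1)] by blast
  then show "p \<in> ears H xs \<union> ears H ys" using p by (auto simp: ears_def)
qed

lemma ears_join3:
  assumes "joinable xs ys" "joinable ys zs" and "hd ys \<in> set H" "hd zs \<in> set H"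
  shows "ears H (xs \<bowtie> ys \<bowtie> zs) \<subseteq> ears H xs \<union> ears H ys \<union> ears H zs"
proof -
  have "ears H (xs \<bowtie> ys \<bowtie> zs) \<subseteq> ears H xs \<union> ears H (ys \<bowtie> zs)"
    using assms joinableD(1)[OF assms(2)] by (intro ears_join) simp_all
  then show ?thesis using ears_join[OF assms(2,4)] by blast
qed

lemma ears_empty: "edges_of q \<subseteq> edges_of H \<Longrightarrow> ears H q = {}"
  using edges_of_sublist[of _ q] by (fastforce simp: ears_def)

lemma ear_around_edge:
  assumes "q = l @ r" "l \<noteq> []" "r \<noteq> []" "{last l, hd r} \<notin> edges_of H"
    and "hd q \<in> set H" "last q \<in> set H"
  obtains xs p1 p2 zs where "l = xs @ p1" "r = p2 @ zs" "p1 \<noteq> []" "p2 \<noteq> []" "p1 @ p2 \<in> ears H q"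
proof -
  have ends: "hd l \<in> set H" "last r \<in> set H" using assms by simp_all
  obtain xs u ys1 where l: "l = xs @ u # ys1" "u \<in> set H" "\<forall>y\<in>set ys1. y \<notin> set H"
    using split_list_last_prop[of l "\<lambda>x. x \<in> set H"] assms(2) ends(1) hd_in_set by metis
  obtain ys2 v zs where r: "r = ys2 @ v # zs" "v \<in> set H" "\<forall>y\<in>set ys2. y \<notin> set H"
    using split_list_first_prop[of r "\<lambda>x. x \<in> set H"] assms(3) ends(2) last_in_set by metis
  let ?p1 = "u # ys1" and ?p2 = "ys2 @ [v]"
  have "{last l, hd r} \<in> edges_of (?p1 @ ?p2)"
    using walk_edges_append[of ?p1 ?p2] l r by (simp add: hd_append)
  then have "\<not> edges_of (?p1 @ ?p2) \<subseteq> edges_of H" using assms(4) by blast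
  moreover have "interior (?p1 @ ?p2) = ys1 @ ys2"
    using interior_Cons_snoc[of u "ys1 @ ys2" v] by simp
  moreover have "sublist (?p1 @ ?p2) q"
    using sublist_appendI[of "?p1 @ ?p2" xs zs] by (simp add: assms(1) l r)
  ultimately have "?p1 @ ?p2 \<in> ears H q"
    using l r unfolding ears_def by auto
  then show thesis using that[of xs ?p1 ?p2 zs] l(1) r(1) by simp
qed

lemma ear_containing_edge:
  assumes "g \<in> edges_of q" "g \<notin> edges_of H" "hd q \<in> set H" "last q \<in> set H"
  obtains p where "p \<in> ears H q" "g \<in> edges_of p"
proof -
  obtain l r where q: "q = l @ r" "l \<noteq> []" "r \<noteq> []" and g: "g = {last l, hd r}"
    using assms(1) by (rule edges_of_split)
  obtain xs p1 p2 zs where "l = xs @ p1" "r = p2 @ zs" "p1 \<noteq> []" "p2 \<noteq> []" "p1 @ p2 \<in> ears H q"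
    using ear_around_edge[OF q _ assms(3,4)] assms(2) g by blast
  then show thesis using that[of "p1 @ p2"] by (simp add: g walk_edges_append)
qed

lemma ear_around_position:
  assumes s: "0 < s" "s < length q" "{q ! (s - 1), q ! s} \<notin> edges_of H"
    and ends: "hd q \<in> set H" "last q \<in> set H"
  obtains r t where "r < s" "s \<le> t" "t < length q" "take (Suc (t - r)) (drop r q) \<in> ears H q"
    "hd (take (Suc (t - r)) (drop r q)) = q ! r" "last (take (Suc (t - r)) (drop r q)) = q ! t"
proof -
  have split_s: "q = take s q @ drop s q" "take s q \<noteq> []" "drop s q \<noteq> []" using s(1,2) by auto
  have "last (take s q) = q ! (s - 1)" using s(1,2) by (subst last_conv_nth) auto
  then have "{last (take s q), hd (drop s q)} \<notin> edges_of H"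
    using s by (simp add: hd_drop_conv_nth)
  then obtain xs p1 p2 zs where split: "take s q = xs @ p1" "drop s q = p2 @ zs" "p1 \<noteq> []" "p2 \<noteq> []"
    and ear: "p1 @ p2 \<in> ears H q"
    using ends by (rule ear_around_edge[OF split_s])
  define p where "p = p1 @ p2"
  let ?r = "length xs" and ?t = "length xs + length p - 1"
  obtain u ys v where p: "p = u # ys @ [v]" using ear unfolding p_def by (rule ear_shape)
  have q: "q = xs @ p @ zs" using split append_take_drop_id[of s q] by (simp add: p_def)
  have "s = length xs + length p1" using arg_cong[OF split(1), of length] s(2) by simp
  then have bounds: "?r < s" "s \<le> ?t"
    using split(3,4) by (simp_all add: p_def Suc_le_eq flip: length_greater_0_conv)
  have slice: "take (Suc (?t - ?r)) (drop ?r q) = p" by (simp add: q p)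
  show thesis
  proof (rule that[OF bounds])
    show "take (Suc (?t - ?r)) (drop ?r q) \<in> ears H q"
      unfolding slice using ear by (simp add: p_def)
  qed (unfold slice, simp_all add: q p nth_append)
qed

lemma ear_admissible:
  assumes "trail V E q" "p \<in> ears H q" "f \<notin> edges_of p"
  shows "admissible V E H f (hd p) (last p) p"
proof -
  have "p \<noteq> []" using assms(2) by (auto elim: ear_shape)
  then have "trail V E p" using trail_sublist assms(1) sublist_ear[OF assms(2)] by blast
  then have "trail V (E - edges_of H - {f}) p"
    using ear_edges_disjoint[OF assms(2)] assms(3) unfolding trail_def walk_def by blast
  then show ?thesis
    using ear_vertices[OF assms(2)] ear_interior[OF assms(2)] unfolding admissible_def by blast
qed

lemma ears_of_path:
  assumes "distinct p" "set p \<inter> set H \<subseteq> {hd p, last p}" "c \<in> ears H p"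
  shows "{hd c, last c} = {hd p, last p}"
proof -
  obtain u ys v where c: "c = u # ys @ [v]" using assms(3) by (rule ear_shape)
  have sub: "sublist c p" using sublist_ear[OF assms(3)] .
  then have "distinct c" using assms(1) by (auto simp: sublist_def)
  then have "hd c \<noteq> last c" by (auto simp: c)
  moreover have "{hd c, last c} \<subseteq> set c \<inter> set H" using ear_ends[OF assms(3)] by (simp add: c)
  then have "{hd c, last c} \<subseteq> {hd p, last p}" using assms(2) set_mono_sublist[OF sub] by blast
  ultimately show ?thesis by auto
qed

lemma excise_closed_ear:
  assumes tr: "trail V E q" and no_loop: "\<And>u. {u} \<notin> E" and p: "p \<in> ears H q" "hd p = last p"
  obtains q' where "length q' < length q" "trail V E q'" "edges_of q \<inter> edges_of H \<subseteq> edges_of q'"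
    "hd q' = hd q" "last q' = last q" "ears H q' \<subseteq> ears H q"
    "\<And>c. set c \<subseteq> set H \<Longrightarrow> traverses q c \<Longrightarrow> traverses q' c"
proof -
  obtain u ys where p_eq: "p = u # ys @ [u]" using ear_shape[OF p(1)] p(2) by fastforce
  obtain xs zs where "q = xs @ p @ zs" using sublist_ear[OF p(1)] by (auto simp: sublist_def)
  then have q: "q = (xs @ [u]) \<bowtie> p \<bowtie> (u # zs)" by (simp add: p_eq join_def)
  let ?xs = "xs @ [u]" and ?zs = "u # zs"
  have join: "joinable ?xs p" "joinable p ?zs" "joinable ?xs ?zs"
    by (simp_all add: p_eq joinable_def)
  have "edges_of p \<subseteq> E" using tr join by (simp add: q trail_join_iff trail_def walk_def)
  then have ys: "ys \<noteq> []" using no_loop[of u] by (auto simp: p_eq)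
  have "sublist ?xs q" unfolding q by (rule sublist_join_left)
  moreover have "sublist ?zs q"
    unfolding q using join(1,2) by (rule sublist_join_rightmost)
  moreover have "u \<in> set H" using ear_ends[OF p(1)] by (simp add: p_eq)
  ultimately have ears: "ears H (?xs \<bowtie> ?zs) \<subseteq> ears H q"
    using ears_join[OF join(3), of H] ears_sublist[of _ q H] by fastforce
  have trav: "traverses (?xs \<bowtie> ?zs) c" if "set c \<subseteq> set H" "traverses q c" for c
  proof -
    have "set c \<inter> set (interior p) = {}" using that(1) ear_interior[OF p(1)] by blast
    then have "traverses ?xs c \<or> traverses ?zs c"
      using that(2) ys join unfolding q
      by (intro traverses_cut_interior[where mid = p]) (simp_all add: p_eq)
    then show ?thesis using join(3) by (rule traverses_join)
  qed
  show thesis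
  proof (rule that[OF _ _ _ _ _ ears trav])
    show "trail V E (?xs \<bowtie> ?zs)" using tr join by (auto simp: q trail_join_iff)
    show "edges_of q \<inter> edges_of H \<subseteq> edges_of (?xs \<bowtie> ?zs)"
      using join ear_edges_disjoint[OF p(1)] by (auto simp: q)
    show "hd (?xs \<bowtie> ?zs) = hd q" "last (?xs \<bowtie> ?zs) = last q" using join by (simp_all add: q)
  qed (simp_all add: q p_eq join_def)
qed

lemma trail_rotate:
  assumes "trail V E (xs \<bowtie> mid \<bowtie> zs)" "joinable xs mid" "joinable mid zs"
    and "trail V E p" "joinable (rev xs) p" "joinable p zs"
    and "edges_of p \<inter> edges_of (xs \<bowtie> mid \<bowtie> zs) = {}"
  shows "trail V E (rev xs \<bowtie> p \<bowtie> zs)"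
  using assms by (auto simp: trail_join_iff)

subsection \<open>Segmented circuits\<close>

lemma distinct_concat_map_disjoint:
  "distinct (concat (map f xs)) \<Longrightarrow> x \<in> set xs \<Longrightarrow> y \<in> set xs \<Longrightarrow> x \<noteq> y \<Longrightarrow>
   set (f x) \<inter> set (f y) = {}"
  by (induction xs) auto

locale segmented_circuit =
  fixes V :: "'a set" and E :: "'a set set" and k :: nat and e :: "nat \<Rightarrow> 'a set"
    and Hs :: "nat \<Rightarrow> 'a list" and H :: "'a list" and f :: "'a set"
  assumes simple: "simple_graph V E"
    and k_pos: "k \<ge> 1"
    and circuit_H: "circuit V E H"
    and segments: "segmentation k e Hs H"
begin

abbreviation free_edges :: "'a set set" where
  "free_edges \<equiv> E - edges_of H - {f}"

abbreviation Cl :: "'a set \<Rightarrow> 'a set" where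
  "Cl \<equiv> cl k Hs"

abbreviation Reach :: "'a set \<Rightarrow> 'a set" where
  "Reach \<equiv> reach V E H f"

abbreviation Layer :: "'a \<Rightarrow> nat \<Rightarrow> 'a set" where
  "Layer \<equiv> layer V E k Hs H f"

definition free_path :: "'a list \<Rightarrow> bool" where
  "free_path p \<longleftrightarrow> walk V free_edges p \<and> distinct p \<and> set p \<inter> set H \<subseteq> {hd p, last p}"

lemma free_pathD:
  assumes "free_path p"
  shows "walk V free_edges p" "distinct p" "set p \<inter> set H \<subseteq> {hd p, last p}"
  using assms by (simp_all add: free_path_def)

lemma edge_doubleton: "g \<in> E \<Longrightarrow> \<exists>u v. g = {u, v} \<and> u \<noteq> v"
  using simple unfolding simple_graph_def by blast

lemma no_loops: "{u} \<notin> E"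
  using edge_doubleton[of "{u}"] by auto

lemma trail_H: "trail V E H" and closed_H: "hd H = last H"
  using circuit_H by (simp_all add: circuit_def)

lemma H_subset_V: "set H \<subseteq> V"
  using trail_H by (simp add: trail_def walk_def)

lemma H_eq: "H = concat (map Hs [1..<Suc k]) @ [hd (Hs 1)]"
  using segments by (simp add: segmentation_def)

lemma segment_nonempty: "j \<in> {1..k} \<Longrightarrow> Hs j \<noteq> []"
  using segments by (simp add: segmentation_def)

lemma vertices_H: "set H = (\<Union>j\<in>{1..k}. set (Hs j))"
proof -
  have "set H = (\<Union>j\<in>{1..k}. set (Hs j)) \<union> {hd (Hs 1)}"
    by (subst H_eq) (auto simp del: upt_Suc simp: less_Suc_eq_le)
  moreover have "hd (Hs 1) \<in> (\<Union>j\<in>{1..k}. set (Hs j))"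
    using segment_nonempty[of 1] k_pos by (intro UN_I[of 1]) auto
  ultimately show ?thesis by blast
qed

lemma walk_edges_H: "walk_edges H = concat (map (\<lambda>j. walk_edges (Hs j) @ [e j]) [1..<Suc k])"
proof -
  define next_hd where "next_hd j = hd (Hs (if j = k then 1 else Suc j))" for j
  have e: "e j = {last (Hs j), next_hd j}" if "j \<in> {1..k}" for j
    using segments that by (simp add: segmentation_def next_hd_def)
  have seg: "walk_edges (Hs j @ [next_hd j]) = walk_edges (Hs j) @ [e j]" if "j \<in> {1..k}" for j
    using walk_edges_append[of "Hs j" "[next_hd j]"] segment_nonempty[OF that] e[OF that] by simp
  have "walk_edges (concat (map Hs [1..<Suc i]) @ [next_hd i]) =
      concat (map (\<lambda>j. walk_edges (Hs j) @ [e j]) [1..<Suc i])" if "1 \<le> i" "i \<le> k" for i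
    using that
  proof (induction i rule: nat_induct_at_least)
    case base
    then show ?case using seg[of 1] by simp
  next
    case (Suc i)
    let ?C = "concat (map Hs [1..<Suc i])"
    have ne: "Hs (Suc i) \<noteq> []" using segment_nonempty Suc.prems by simp
    then have next_hd: "next_hd i = hd (Hs (Suc i))" using Suc.prems by (simp add: next_hd_def)
    have "concat (map Hs [1..<Suc (Suc i)]) @ [next_hd (Suc i)]
        = (?C @ [next_hd i]) \<bowtie> (Hs (Suc i) @ [next_hd (Suc i)])"
      using ne next_hd Suc.hyps by (cases "Hs (Suc i)") (simp_all add: join_def)
    also have "walk_edges \<dots> =
        walk_edges (?C @ [next_hd i]) @ walk_edges (Hs (Suc i) @ [next_hd (Suc i)])"
      using ne next_hd by (intro walk_edges_join) (simp add: joinable_def)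
    finally show ?case using Suc.IH Suc.prems Suc.hyps seg[of "Suc i"] by simp
  qed
  from this[of k] show ?thesis using k_pos H_eq by (simp add: next_hd_def del: upt_Suc)
qed

lemma marked_edge_in_H: "i \<in> {1..k} \<Longrightarrow> e i \<in> edges_of H"
  unfolding walk_edges_H by (auto simp del: upt_Suc simp: less_Suc_eq_le)

lemma marked_edge_notin_segment:
  assumes "i \<in> {1..k}" "j \<in> {1..k}"
  shows "e i \<notin> edges_of (Hs j)"
proof -
  let ?F = "\<lambda>j. walk_edges (Hs j) @ [e j]"
  have dist: "distinct (concat (map ?F [1..<Suc k]))"
    using trail_H by (simp add: trail_def walk_edges_H del: upt_Suc)
  have idx: "i \<in> set [1..<Suc k]" "j \<in> set [1..<Suc k]"
    using assms by (simp_all add: less_Suc_eq_le del: upt_Suc)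
  show ?thesis
  proof (cases "i = j")
    case True
    have "?F j \<in> set (map ?F [1..<Suc k])" using idx(2) by (simp del: upt_Suc)
    then have "distinct (?F j)" using dist unfolding distinct_concat_iff by blast
    then show ?thesis using True by simp
  next
    case False
    then show ?thesis using distinct_concat_map_disjoint[OF dist idx] by auto
  qed
qed

lemma split_at_segment:
  assumes "j \<in> {1..k}"
  obtains xs zs where "H = xs @ Hs j @ zs"
    "\<And>i. i \<in> {1..k} \<Longrightarrow> i \<noteq> j \<Longrightarrow> sublist (Hs i) xs \<or> sublist (Hs i) zs"
proof -
  let ?xs = "concat (map Hs [1..<j])" and ?zs = "concat (map Hs [Suc j..<Suc k]) @ [hd (Hs 1)]"
  have "[1..<Suc k] = [1..<j] @ j # [Suc j..<Suc k]"
    using assms upt_add_eq_append[of 1 j "Suc k - j"] upt_conv_Cons[of j "Suc k"] by simp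
  then have H: "H = ?xs @ Hs j @ ?zs" by (subst H_eq) (simp del: upt_Suc)
  have member: "sublist (Hs i) (concat (map Hs js))" if "i \<in> set js" for i js
    using split_list[OF that] by (auto simp: sublist_append)
  show thesis
  proof (rule that[OF H])
    fix i assume "i \<in> {1..k}" "i \<noteq> j"
    then have "i \<in> set [1..<j] \<or> i \<in> set [Suc j..<Suc k]" by (auto simp del: upt_Suc)
    then show "sublist (Hs i) ?xs \<or> sublist (Hs i) ?zs"
      using member sublist_append[of "Hs i" _ "[hd (Hs 1)]"] by metis
  qed
qed

lemma vertices_cl_seg_subset_H: "j \<in> {1..k} \<Longrightarrow> set (cl_seg (Hs j) U) \<subseteq> set H"
  using set_cl_seg_subset[of "Hs j" U] unfolding vertices_H by blast

lemma Cl_subset_H: "Cl U \<subseteq> set H"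
  unfolding cl_def using vertices_cl_seg_subset_H by blast

lemma subset_Cl: "U \<subseteq> set H \<Longrightarrow> U \<subseteq> Cl U"
  unfolding cl_def vertices_H using Int_subset_cl_seg[of U] by blast

lemma Cl_empty [simp]: "Cl {} = {}"
  by (simp add: cl_def cl_seg_eq_Nil_iff)

lemma Reach_walk:
  assumes "walk V free_edges p" "hd p \<in> X" "last p \<in> set H" "set p \<inter> set H \<subseteq> {hd p, last p}"
  shows "last p \<in> Reach X"
proof -
  obtain p' where "walk V free_edges p'" "distinct p'" "hd p' = hd p" "last p' = last p"
    "set p' \<subseteq> set p"
    using walk_to_path[OF assms(1)] .
  then have "admissible V E H f (hd p) (last p) p'"
    using assms distinct_walk_edges[of p'] by (auto simp: admissible_def trail_def)
  then show ?thesis using assms(2,3) by (auto simp: reach_def)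
qed

lemma Reach_path:
  assumes "y \<in> Reach X"
  obtains p where "free_path p" "hd p \<in> X" "last p = y"
proof -
  obtain x q where "x \<in> X" and q: "admissible V E H f x y q" using assms by (auto simp: reach_def)
  then have "walk V free_edges q" by (simp add: admissible_def trail_def)
  then obtain p where "walk V free_edges p" "distinct p" "hd p = hd q" "last p = last q"
    "set p \<subseteq> set q"
    by (rule walk_to_path)
  then show thesis using q \<open>x \<in> X\<close> that[of p] by (auto simp: admissible_def free_path_def)
qed

lemma Reach_subset_H: "Reach X \<subseteq> set H"
  by (auto simp: reach_def)

lemma Reach_empty [simp]: "Reach {} = {}"
  by (simp add: reach_def)

lemma Int_H_subset_Reach: "X \<inter> set H \<subseteq> Reach X"
  using Reach_walk[of "[x]" X for x] H_subset_V by (auto simp: walk_def)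

lemma Layer_subset_H: "Layer v i \<subseteq> set H"
  by (cases "(V, E, k, Hs, H, f, v, i)" rule: layer.cases) (simp_all add: Reach_subset_H)

lemma subset_Reach_Cl: "U \<subseteq> set H \<Longrightarrow> U \<subseteq> Reach (Cl U)"
  using subset_Cl Int_H_subset_Reach[of "Cl U"] by blast

lemma Reach_Cl_Layer: "Reach (Cl (Layer v i)) \<subseteq> Layer v (Suc i)"
  by (cases i) simp_all

lemma Layer_mono: "Layer v i \<subseteq> Layer v (Suc i)"
  using subset_Reach_Cl[OF Layer_subset_H] Reach_Cl_Layer by blast

lemma first_Layer_meeting:
  assumes "Layer v i \<inter> S \<noteq> {}"
  obtains c where "c < i" "Layer v c \<inter> S = {}" "Layer v (Suc c) \<inter> S \<noteq> {}"
proof -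
  have "\<exists>c<i. (\<forall>i\<le>c. \<not> Layer v i \<inter> S \<noteq> {}) \<and> Layer v (Suc c) \<inter> S \<noteq> {}"
    using assms by (intro ex_least_nat_less) simp_all
  then show thesis using that by blast
qed

subsection \<open>Coherence in terms of ears\<close>

definition separated :: "'a set \<Rightarrow> 'a set \<Rightarrow> 'a list \<Rightarrow> bool" where
  "separated X Y p \<longleftrightarrow> f \<notin> edges_of p \<and> \<not> {hd p, last p} \<subseteq> X \<and> \<not> {hd p, last p} \<subseteq> Y"

lemma separated_antimono: "separated X Y p \<Longrightarrow> X' \<subseteq> X \<Longrightarrow> separated X' Y p"
  by (auto simp: separated_def)

lemma separated_commute: "separated X Y p \<longleftrightarrow> separated Y X p"
  by (auto simp: separated_def)

lemma separated_rev [simp]: "separated X Y (rev p) \<longleftrightarrow> separated X Y p"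
proof -
  have "{hd (rev p), last (rev p)} = {hd p, last p}"
    by (cases "p = []") (auto simp: hd_rev last_rev)
  then show ?thesis by (simp only: separated_def walk_edges_rev set_rev)
qed

text \<open>
  \<open>A, A'\<close> stand for \<open>A\<^sub>n, A\<^sub>n\<^sub>+\<^sub>1\<close>, and \<open>B, B'\<close> for \<open>B\<^sub>m, B\<^sub>m\<^sub>+\<^sub>1\<close>. Of (C3) only this is kept: the closures
  run along \<open>q\<close>, in either direction. No positions have to be tracked.
\<close>

definition ear_coherent :: "'a set \<Rightarrow> 'a set \<Rightarrow> 'a set \<Rightarrow> 'a set \<Rightarrow> 'a list \<Rightarrow> bool" where
  "ear_coherent A A' B B' q \<longleftrightarrow>
     trail V E q \<and> e ` {1..k} \<subseteq> edges_of q \<and> hd q \<in> A' \<and> last q \<in> B' \<and>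
     (\<forall>p\<in>ears H q. separated A' B' p) \<and>
     (\<forall>j\<in>{1..k}. traverses q (cl_seg (Hs j) A) \<and> traverses q (cl_seg (Hs j) B))"

lemma ear_coherent_rev:
  assumes "ear_coherent A A' B B' q"
  shows "ear_coherent B B' A A' (rev q)"
proof -
  have "q \<noteq> []" using assms by (auto simp: ear_coherent_def trail_def walk_def)
  then show ?thesis
    using assms by (auto simp: ear_coherent_def hd_rev last_rev ears_rev separated_commute)
qed

lemma ear_coherent_shrink:
  assumes "ear_coherent A A' B B' q" "hd q \<in> A" "A0 \<subseteq> A" "A \<subseteq> A'"
  shows "ear_coherent A0 A B B' q"
proof -
  have "\<forall>p\<in>ears H q. separated A B' p"
    using assms(1) separated_antimono[OF _ assms(4)] unfolding ear_coherent_def by blast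
  moreover have "traverses q (cl_seg (Hs j) A0)" if "j \<in> {1..k}" for j
    using assms(1) that sublist_traverses[OF _ sublist_cl_seg_mono[OF assms(3)]]
    unfolding ear_coherent_def by blast
  ultimately show ?thesis using assms(1,2) unfolding ear_coherent_def by simp
qed

lemma excise_closed_ears:
  assumes "trail V E q" "e ` {1..k} \<subseteq> edges_of q" "hd q \<in> A'" "last q \<in> B'"
    and "\<forall>p\<in>ears H q. hd p \<noteq> last p \<longrightarrow> separated A' B' p"
    and "\<forall>j\<in>{1..k}. traverses q (cl_seg (Hs j) A) \<and> traverses q (cl_seg (Hs j) B)"
  shows "\<exists>q'. ear_coherent A A' B B' q'"
  using assms
proof (induction "length q" arbitrary: q rule: less_induct)
  case less
  show ?case
  proof (cases "\<exists>p\<in>ears H q. hd p = last p")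
    case False
    then show ?thesis using less.prems unfolding ear_coherent_def by blast
  next
    case True
    then obtain p where p: "p \<in> ears H q" "hd p = last p" by blast
    obtain q' where q': "length q' < length q" "trail V E q'"
      "edges_of q \<inter> edges_of H \<subseteq> edges_of q'" "hd q' = hd q" "last q' = last q"
      "ears H q' \<subseteq> ears H q" "\<And>c. set c \<subseteq> set H \<Longrightarrow> traverses q c \<Longrightarrow> traverses q' c"
      using excise_closed_ear[OF less.prems(1) no_loops p] by metis
    show ?thesis
    proof (rule less.hyps[OF q'(1,2)])
      show "e ` {1..k} \<subseteq> edges_of q'" using less.prems(2) marked_edge_in_H q'(3) by blast
      show "\<forall>j\<in>{1..k}. traverses q' (cl_seg (Hs j) A) \<and> traverses q' (cl_seg (Hs j) B)"
        using less.prems(6) q'(7) vertices_cl_seg_subset_H by blast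
    qed (use less.prems q' in auto)
  qed
qed

subsection \<open>Cutting the circuit open\<close>

lemma open_circuit:
  assumes j: "j \<in> {1..k}" and split: "Hs j = ls \<bowtie> mid \<bowtie> rs" "joinable ls mid" "joinable mid rs"
    and ends: "last mid \<in> A'" "hd mid \<in> B'"
    and miss: "A \<inter> set (Hs j) = {}" "B \<inter> set (Hs j) = {}"
  shows "\<exists>q. ear_coherent A A' B B' q"
proof -
  obtain xs zs where H: "H = xs @ Hs j @ zs"
    and other: "\<And>i. i \<in> {1..k} \<Longrightarrow> i \<noteq> j \<Longrightarrow> sublist (Hs i) xs \<or> sublist (Hs i) zs"
    using split_at_segment[OF j] by blast
  define q1 q2 where "q1 = xs @ ls" and "q2 = rs @ zs"
  have H_join: "H = q1 \<bowtie> mid \<bowtie> q2"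
    using joinableD[OF split(3)] by (simp add: H split(1) q1_def q2_def join_def)
  have join: "joinable q1 mid" "joinable mid q2"
    using split(2,3) by (simp_all add: joinable_def q1_def q2_def)
  have "hd H = hd q1" "last H = last q2"
    using join joinableD(1)[OF join(1)] by (simp_all add: H_join)
  then have join': "joinable q2 q1"
    using closed_H joinableD(1)[OF join(1)] joinableD(2)[OF join(2)] by (simp add: joinable_def)
  let ?q = "q2 \<bowtie> q1"
  have trail: "trail V E ?q"
    using trail_H join join' by (auto simp: H_join trail_join_iff)
  have "edges_of H = edges_of ?q \<union> edges_of mid" using join join' by (auto simp: H_join)
  moreover have "edges_of mid \<subseteq> edges_of (Hs j)" using split by auto
  ultimately have marked: "e ` {1..k} \<subseteq> edges_of ?q"
    using marked_edge_in_H marked_edge_notin_segment[OF _ j] by blast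
  have "edges_of ?q \<subseteq> edges_of H" using join join' by (auto simp: H_join)
  then have no_ears: "ears H ?q = {}" by (rule ears_empty)
  have trav: "traverses ?q (cl_seg (Hs i) U)" if "i \<in> {1..k}" "U \<inter> set (Hs j) = {}" for i U
  proof (cases "i = j")
    case False
    then have "sublist (Hs i) q1 \<or> sublist (Hs i) q2"
      using other[OF that(1)] by (auto simp: q1_def q2_def sublist_append)
    then have "traverses q2 (Hs i) \<or> traverses q1 (Hs i)" by (auto simp: traverses_def)
    then show ?thesis using sublist_traverses[OF traverses_join[OF _ join'] sublist_cl_seg] by blast
  next
    case True
    then have "cl_seg (Hs i) U = []" using that(2) by (simp add: cl_seg_eq_Nil_iff)
    then show ?thesis by simp
  qed
  have "hd ?q \<in> A'" "last ?q \<in> B'"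
    using ends join' joinableD[OF join(1)] joinableD[OF join(2)] by simp_all
  then have "ear_coherent A A' B B' ?q"
    using trail marked no_ears trav miss unfolding ear_coherent_def by simp
  then show ?thesis ..
qed

lemma open_circuit_in_common_segment:
  assumes j: "j \<in> {1..k}" and meet: "A' \<inter> set (Hs j) \<noteq> {}" "B' \<inter> set (Hs j) \<noteq> {}"
    and miss: "A \<inter> set (Hs j) = {}" "B \<inter> set (Hs j) = {}"
  shows "\<exists>q. ear_coherent A A' B B' q"
proof -
  obtain x y where xy: "x \<in> A'" "x \<in> set (Hs j)" "y \<in> B'" "y \<in> set (Hs j)" using meet by blast
  obtain ls mid rs where split: "Hs j = ls \<bowtie> mid \<bowtie> rs" "joinable ls mid" "joinable mid rs"
    "hd mid = x \<and> last mid = y \<or> hd mid = y \<and> last mid = x"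
    using split_at_two_vertices[OF xy(2,4)] .
  from split(4) show ?thesis
  proof
    assume "hd mid = x \<and> last mid = y"
    then have "\<exists>q. ear_coherent B B' A A' q" using open_circuit[OF j split(1-3)] xy miss by blast
    then show ?thesis using ear_coherent_rev by blast
  next
    assume "hd mid = y \<and> last mid = x"
    then show ?thesis using open_circuit[OF j split(1-3)] xy miss by blast
  qed
qed

subsection \<open>Rotation\<close>

lemma Reach_concat:
  assumes "walk V free_edges p" "hd p \<in> X" "set p \<inter> set H \<subseteq> {hd p}"
    and "walk V free_edges q" "last q \<in> set H" "set (tl q) \<inter> set H \<subseteq> {last q}" and "joinable p q"
  shows "last q \<in> Reach X"
proof -
  have "set (p \<bowtie> q) \<inter> set H \<subseteq> {hd p, last q}"
    using assms(3,6) by (auto simp: join_def)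
  moreover have "walk V free_edges (p \<bowtie> q)" using assms by (simp add: walk_join_iff)
  ultimately show ?thesis
    using Reach_walk[of "p \<bowtie> q" X] assms(2,5,7) joinableD(1)[OF assms(7)] by simp
qed

lemma ear_last_reached:
  assumes c: "c \<in> ears H q" "walk V free_edges c"
    and p: "free_path p" "hd p \<in> X" "last p \<in> set H"
    and z: "z \<in> set p" "z \<in> set c" "z \<notin> set H"
  shows "last c \<in> Reach X"
proof -
  obtain p1 p2 where p12: "p = p1 \<bowtie> p2" "joinable p1 p2" "last p1 = z"
    using split_joinable[OF z(1)] .
  obtain c1 c2 where c12: "c = c1 \<bowtie> c2" "joinable c1 c2" "last c1 = z"
    using split_joinable[OF z(2)] .
  have walks: "walk V free_edges p1" "walk V free_edges c2"
    using free_pathD(1)[OF p(1)] p12 c(2) c12 by (simp_all add: walk_join_iff)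
  have "hd p2 \<noteq> last p2" using p(3) p12 z(3) joinableD[OF p12(2)] by auto
  then have "last p2 \<in> set (tl p2)" using joinableD[OF p12(2)] by (cases p2) auto
  then have "last p \<in> set (tl p2)" using p12 by simp
  then have "last p \<notin> set p1" using free_pathD(2)[OF p(1)] p12(1) by (auto simp: join_def)
  then have p1: "set p1 \<inter> set H \<subseteq> {hd p1}" "hd p1 \<in> X"
    using free_pathD(3)[OF p(1)] p(2) p12 joinableD[OF p12(2)] by auto
  have "set (tl c) \<inter> set H \<subseteq> {last c}"
    using c(1) ear_interior[OF c(1)] by (auto elim!: ear_shape)
  moreover have "set (tl c2) \<subseteq> set (tl c)"
    using c12(1) joinableD(1)[OF c12(2)] by (simp add: join_def)
  moreover have "last c = last c2" using c12(1,2) by simp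
  ultimately have "set (tl c2) \<inter> set H \<subseteq> {last c2}" by auto
  moreover have "last c2 \<in> set H" using ear_ends[OF c(1)] c12 by simp
  moreover have "joinable p1 c2" using p12 c12 joinableD by (simp add: joinable_def)
  ultimately have "last c2 \<in> Reach X" using Reach_concat[OF walks(1) p1(2,1) walks(2)] by blast
  then show ?thesis using c12 by simp
qed

lemma ear_ends_reached:
  assumes c: "c \<in> ears H q" "walk V E c" "f \<notin> edges_of c"
    and p: "free_path p" "hd p \<in> X" "hd p \<in> set H" "last p \<in> set H"
    and common: "edges_of p \<inter> edges_of c \<noteq> {}"
  shows "{hd c, last c} \<subseteq> Reach X"
proof -
  obtain g where g: "g \<in> edges_of p" "g \<in> edges_of c" using common by blast
  have gp: "g \<subseteq> set p" and gc: "g \<subseteq> set c" using g edge_subset_vertices by blast+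
  show ?thesis
  proof (cases "g \<subseteq> set H")
    case True
    obtain y z where yz: "g = {y, z}" "y \<noteq> z"
      using edge_doubleton g(2) c(2) unfolding walk_def by blast
    have "g \<subseteq> {hd p, last p}" using gp True free_pathD(3)[OF p(1)] by blast
    then have "g = {hd p, last p}" using yz by auto
    moreover have "g \<subseteq> {hd c, last c}"
      using gc True ear_vertices[OF c(1)] ear_interior[OF c(1)] by blast
    then have "g = {hd c, last c}" using yz by auto
    moreover have "hd p \<in> Reach X" using Int_H_subset_Reach p(2,3) by blast
    moreover have "last p \<in> Reach X"
      using Reach_walk[OF free_pathD(1)[OF p(1)] p(2,4) free_pathD(3)[OF p(1)]] .
    ultimately show ?thesis by auto
  next
    case False
    then obtain z where z: "z \<in> set p" "z \<in> set c" "z \<notin> set H" using gp gc by blast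
    have free: "walk V free_edges c"
      using c(2,3) ear_edges_disjoint[OF c(1)] by (auto simp: walk_def)
    have "last c \<in> Reach X" using ear_last_reached[OF c(1) free p(1,2,4) z] .
    moreover have "rev c \<in> ears H (rev q)" using c(1) by (simp add: ears_rev)
    then have "last (rev c) \<in> Reach X"
      using ear_last_reached[of "rev c" "rev q" p X z] free p z by simp
    then have "hd c \<in> Reach X" using z(2) by (auto simp: last_rev)
    ultimately show ?thesis by simp
  qed
qed

lemma free_path_edges_disjoint:
  assumes q: "walk V E q" "hd q \<in> set H" "last q \<in> set H"
    and sep: "\<forall>c\<in>ears H q. separated (Reach X) Y c"
    and p: "free_path p" "hd p \<in> X" "hd p \<in> set H" "last p \<in> set H"
  shows "edges_of p \<inter> edges_of q = {}"
proof (rule ccontr)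
  assume "edges_of p \<inter> edges_of q \<noteq> {}"
  then obtain g where g: "g \<in> edges_of p" "g \<in> edges_of q" by blast
  then have "g \<notin> edges_of H" using free_pathD(1)[OF p(1)] by (auto simp: walk_def)
  then obtain c where c: "c \<in> ears H q" "g \<in> edges_of c"
    using ear_containing_edge[OF g(2) _ q(2,3)] by blast
  then have "walk V E c" using walk_sublist[OF q(1) sublist_ear[OF c(1)]] by (auto elim: ear_shape)
  then have "{hd c, last c} \<subseteq> Reach X"
    using ear_ends_reached[OF c(1) _ _ p] sep c g(1) unfolding separated_def by blast
  then show False using sep c(1) unfolding separated_def by blast
qed

lemma free_path_ears_separated:
  assumes p: "free_path p" and ends: "\<not> {hd p, last p} \<subseteq> X" "\<not> {hd p, last p} \<subseteq> Y"
    and c: "c \<in> ears H p"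
  shows "separated X Y c"
proof -
  have "edges_of c \<subseteq> free_edges"
    using edges_of_sublist[OF sublist_ear[OF c]] free_pathD(1)[OF p] by (auto simp: walk_def)
  then show ?thesis
    using ears_of_path[OF free_pathD(2,3)[OF p] c] ends by (auto simp: separated_def)
qed

lemma entering_free_path:
  assumes coh: "ear_coherent X (Reach (Cl X)) Y Y' q"
    and "Reach (Cl A) \<subseteq> X" "Y' \<subseteq> set H" "hd q \<notin> X"
  obtains p where "free_path p" "hd p \<in> Cl X - Cl A" "last p = hd q" "edges_of p \<inter> edges_of q = {}"
proof -
  have q: "trail V E q" "hd q \<in> Reach (Cl X)" "last q \<in> Y'"
    and sep: "\<forall>c\<in>ears H q. separated (Reach (Cl X)) Y' c"
    using coh by (simp_all add: ear_coherent_def)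
  obtain p where p: "free_path p" "hd p \<in> Cl X" "last p = hd q"
    using Reach_path[OF q(2)] .
  have ends: "hd p \<in> set H" "last p \<in> set H" "last q \<in> set H"
    using subsetD[OF Cl_subset_H p(2)] subsetD[OF Reach_subset_H q(2)] p(3) q(3) assms(3) by auto
  show thesis
  proof (rule that[OF p(1) _ p(3)])
    have "last p \<in> Reach (Cl A)" if "hd p \<in> Cl A"
      using Reach_walk[OF free_pathD(1)[OF p(1)] that ends(2) free_pathD(3)[OF p(1)]] .
    then show "hd p \<in> Cl X - Cl A" using p(2,3) assms(2,4) by auto
    show "edges_of p \<inter> edges_of q = {}"
      using free_path_edges_disjoint[OF _ _ ends(3) sep p(1,2) ends(1,2)] q(1) p(3) ends(2)
      by (simp add: trail_def)
  qed
qed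

lemma cut_along_closure:
  assumes j: "j \<in> {1..k}" and "traverses q (cl_seg (Hs j) X)" and x: "x \<in> set (cl_seg (Hs j) X)"
  obtains xs mid zs where "q = xs \<bowtie> mid \<bowtie> zs" "joinable xs mid" "joinable mid zs"
    "hd mid \<in> X" "last mid = x" "X \<inter> set (tl mid) = {}" "set mid \<subseteq> set (Hs j)"
    "e ` {1..k} \<inter> edges_of mid = {}"
proof -
  let ?C = "cl_seg (Hs j) X"
  have "?C \<noteq> []" using x by auto
  then have "{hd ?C, last ?C} \<subseteq> X" using cl_seg_ends by blast
  then obtain xs mid zs where cut: "q = xs \<bowtie> mid \<bowtie> zs" "joinable xs mid" "joinable mid zs"
    and mid: "hd mid \<in> X" "last mid = x" "set (tl mid) \<inter> X = {}"
      "set mid \<subseteq> set ?C" "edges_of mid \<subseteq> edges_of ?C"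
    by (rule traverses_cut_at_last[OF assms(2) x])
  show thesis
  proof (rule that[OF cut mid(1,2)])
    show "X \<inter> set (tl mid) = {}" using mid(3) by blast
    show "set mid \<subseteq> set (Hs j)" using order_trans[OF mid(4) set_cl_seg_subset] .
    show "e ` {1..k} \<inter> edges_of mid = {}"
      using mid(5) edges_of_sublist[OF sublist_cl_seg, of "Hs j" X]
        marked_edge_notin_segment[OF _ j] by blast
  qed
qed

lemma ear_coherent_rotate:
  assumes coh: "ear_coherent X X' Y Y' (xs \<bowtie> mid \<bowtie> zs)" and "X \<subseteq> X'"
    and cut: "joinable xs mid" "joinable mid zs" "hd mid \<in> X" "hd xs \<in> set H" "last mid \<in> set H"
    and p: "free_path p" "hd p = last mid" "last p = hd xs"
      "edges_of p \<inter> edges_of (xs \<bowtie> mid \<bowtie> zs) = {}"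
    and new: "hd xs \<notin> X" "last mid \<notin> Y'"
    and marked: "e ` {1..k} \<inter> edges_of mid = {}"
    and trav: "\<And>i U. i \<in> {1..k} \<Longrightarrow> U \<in> {A, Y} \<Longrightarrow>
      traverses xs (cl_seg (Hs i) U) \<or> traverses zs (cl_seg (Hs i) U)"
  shows "ear_coherent A X Y Y' (rev xs \<bowtie> rev p \<bowtie> zs)"
proof -
  let ?q = "xs \<bowtie> mid \<bowtie> zs" and ?r = "rev xs \<bowtie> rev p \<bowtie> zs"
  have "p \<noteq> []" using free_pathD(1)[OF p(1)] by (simp add: walk_def)
  then have join: "joinable (rev xs) (rev p)" "joinable (rev p) zs"
    using p(2,3) joinableD[OF cut(1)] joinableD[OF cut(2)]
    by (simp_all add: joinable_def hd_rev last_rev)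
  have "trail V E (rev p)"
    using free_pathD[OF p(1)] distinct_walk_edges[of p] by (auto simp: trail_def walk_def)
  then have trail: "trail V E ?r"
    using coh cut(1,2) join p(4) by (intro trail_rotate) (auto simp: ear_coherent_def)
  have marked': "e ` {1..k} \<subseteq> edges_of ?r"
    using coh marked cut(1,2) join by (auto simp: ear_coherent_def)
  have ends: "hd ?r \<in> X" "last ?r \<in> Y'"
    using coh cut join joinableD[OF cut(1)] by (simp_all add: ear_coherent_def hd_rev)
  have "separated X Y' c" if c: "c \<in> ears H ?r" for c
  proof -
    have "hd (rev p) \<in> set H" "hd zs \<in> set H"
      using cut(4,5) p(3) joinableD[OF cut(2)] \<open>p \<noteq> []\<close> by (simp_all add: hd_rev)
    then consider d where "c = rev d" "d \<in> ears H xs" | d where "c = rev d" "d \<in> ears H p"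
      | "c \<in> ears H zs"
      using c ears_join3[OF join, of H] by (auto simp: ears_rev)
    moreover have "separated X Y' d" if "d \<in> ears H xs \<union> ears H zs" for d
    proof -
      have "d \<in> ears H ?q"
        using that ears_sublist[OF sublist_join_left[of xs "mid \<bowtie> zs"], of H]
          ears_sublist[OF sublist_join_rightmost[OF cut(1,2)], of H] by blast
      then have "separated X' Y' d" using coh by (simp add: ear_coherent_def)
      then show ?thesis by (rule separated_antimono[OF _ assms(2)])
    qed
    moreover have "separated X Y' d" if "d \<in> ears H p" for d
      using free_path_ears_separated[OF p(1) _ _ that] new p(2,3) by simp
    ultimately show ?thesis by cases simp_all
  qed
  moreover have "traverses ?r (cl_seg (Hs i) U)" if "i \<in> {1..k}" "U \<in> {A, Y}" for i U
    using trav[OF that] join by (intro traverses_join) (auto intro!: traverses_join)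
  ultimately show ?thesis using trail marked' ends by (auto simp: ear_coherent_def)
qed

lemma rotate_into_closure:
  assumes coh: "ear_coherent X (Reach (Cl X)) Y Y' q"
    and X: "A \<subseteq> X" "Reach (Cl A) \<subseteq> X" "X \<subseteq> set H" and Y: "Y \<subseteq> Y'" "Y' \<subseteq> set H"
    and new: "hd q \<notin> X"
    and apart: "\<And>j. j \<in> {1..k} \<Longrightarrow> X \<inter> set (Hs j) = {} \<or> Y' \<inter> set (Hs j) = {}"
  shows "\<exists>q'. ear_coherent A X Y Y' q'"
proof -
  have trav: "traverses q (cl_seg (Hs i) X)" "traverses q (cl_seg (Hs i) Y)" if "i \<in> {1..k}" for i
    using coh that by (simp_all add: ear_coherent_def)
  obtain p where p: "free_path p" "hd p \<in> Cl X - Cl A" "last p = hd q"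
    "edges_of p \<inter> edges_of q = {}"
    using entering_free_path[OF coh X(2) Y(2) new] .
  obtain j where j: "j \<in> {1..k}" "hd p \<in> set (cl_seg (Hs j) X)"
    using p(2) unfolding cl_def by blast
  obtain xs mid zs where cut: "q = xs \<bowtie> mid \<bowtie> zs" "joinable xs mid" "joinable mid zs"
    and mid: "hd mid \<in> X" "last mid = hd p" "X \<inter> set (tl mid) = {}" "set mid \<subseteq> set (Hs j)"
      "e ` {1..k} \<inter> edges_of mid = {}"
    using cut_along_closure[OF j(1) trav(1)[OF j(1)] j(2)] .
  have "X \<inter> set (Hs j) \<noteq> {}" using j(2) cl_seg_eq_Nil_iff[of "Hs j" X] by auto
  then have mid_Y': "Y' \<inter> set mid = {}" using apart[OF j(1)] mid(4) by blast
  have beside_A: "traverses xs (cl_seg (Hs i) A) \<or> traverses zs (cl_seg (Hs i) A)"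
    if i: "i \<in> {1..k}" for i
  proof (rule traverses_cl_seg_cut_last[OF _ cut(2,3)])
    show "traverses (xs \<bowtie> mid \<bowtie> zs) (cl_seg (Hs i) A)"
      using sublist_traverses[OF trav(1)[OF i] sublist_cl_seg_mono[OF X(1)]] unfolding cut(1) .
    show "last mid \<notin> set (cl_seg (Hs i) A)" using p(2) i mid(2) unfolding cl_def by auto
    show "A \<inter> set (tl mid) = {}" using X(1) mid(3) by blast
  qed
  have beside_Y: "traverses xs (cl_seg (Hs i) Y) \<or> traverses zs (cl_seg (Hs i) Y)"
    if i: "i \<in> {1..k}" for i
  proof (rule traverses_cl_seg_cut_hd[OF _ cut(2,3)])
    show "traverses (xs \<bowtie> mid \<bowtie> zs) (cl_seg (Hs i) Y)" using trav(2)[OF i] unfolding cut(1) .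
    show "hd mid \<notin> set (cl_seg (Hs i) Y)"
      using apart[OF i] Y(1) mid(1) set_cl_seg_subset[of "Hs i" Y] cl_seg_eq_Nil_iff[of "Hs i" Y]
      by auto
    show "Y \<inter> set (butlast mid) = {}" using Y(1) mid_Y' in_set_butlastD[of _ mid] by blast
  qed
  have "hd xs = hd q" "last mid \<in> set mid"
    using cut joinableD(1)[OF cut(2)] joinableD(1)[OF cut(3)] by simp_all
  moreover have "hd q \<in> set H" "last mid \<in> set H"
    using coh Reach_subset_H p(2) mid(2) Cl_subset_H by (auto simp: ear_coherent_def)
  ultimately have "ear_coherent A X Y Y' (rev xs \<bowtie> rev p \<bowtie> zs)"
    using p mid mid_Y' new cut(1) beside_A beside_Y
    by (intro ear_coherent_rotate[OF coh[unfolded cut(1)] subset_Reach_Cl[OF X(3)] cut(2,3)])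
      (simp_all, blast+)
  then show ?thesis ..
qed

subsection \<open>Descent\<close>

abbreviation layer_coherent :: "'a \<Rightarrow> 'a \<Rightarrow> nat \<Rightarrow> nat \<Rightarrow> 'a list \<Rightarrow> bool" where
  "layer_coherent a b n m \<equiv>
     ear_coherent (Layer a n) (Layer a (Suc n)) (Layer b m) (Layer b (Suc m))"

lemma layer_coherent_descend_step:
  assumes coh: "layer_coherent a b (Suc n) m q"
  shows "\<exists>c d q'. c + d < Suc n + m \<and> layer_coherent a b c d q'"
proof -
  let ?X = "Layer a (Suc n)" and ?Y = "Layer b (Suc m)"
  consider "hd q \<in> ?X"
    | j where "j \<in> {1..k}" "?X \<inter> set (Hs j) \<noteq> {}" "?Y \<inter> set (Hs j) \<noteq> {}"
    | "hd q \<notin> ?X" "\<And>j. j \<in> {1..k} \<Longrightarrow> ?X \<inter> set (Hs j) = {} \<or> ?Y \<inter> set (Hs j) = {}"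
    by blast
  then show ?thesis
  proof cases
    case 1
    have "layer_coherent a b n m q"
      by (rule ear_coherent_shrink[OF coh 1 Layer_mono Layer_mono])
    then show ?thesis by (intro exI[of _ n] exI[of _ m]) auto
  next
    case 2
    obtain c where c: "c < Suc n" "Layer a c \<inter> set (Hs j) = {}" "Layer a (Suc c) \<inter> set (Hs j) \<noteq> {}"
      using first_Layer_meeting[OF 2(2)] .
    obtain d where d: "d < Suc m" "Layer b d \<inter> set (Hs j) = {}" "Layer b (Suc d) \<inter> set (Hs j) \<noteq> {}"
      using first_Layer_meeting[OF 2(3)] .
    have "c + d < Suc n + m" using c(1) d(1) by simp
    then show ?thesis
      using open_circuit_in_common_segment[OF 2(1) c(3) d(3) c(2) d(2)] by blast
  next
    case 3
    have "ear_coherent ?X (Reach (Cl ?X)) (Layer b m) ?Y q" using coh by simp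
    then have "\<exists>q'. layer_coherent a b n m q'"
      by (rule rotate_into_closure[OF _ Layer_mono Reach_Cl_Layer Layer_subset_H
            Layer_mono Layer_subset_H 3])
    then show ?thesis by (intro exI[of _ n] exI[of _ m]) simp
  qed
qed

lemma layer_coherent_descend:
  "layer_coherent a b n m q \<Longrightarrow> \<exists>q'. layer_coherent a b 0 0 q'"
proof (induction "n + m" arbitrary: n m q rule: less_induct)
  case less
  consider "n = 0" "m = 0" | n' where "n = Suc n'" | m' where "m = Suc m'"
    by (cases n; cases m) auto
  then show ?case
  proof cases
    case 1
    then show ?thesis using less.prems by blast
  next
    case 2
    then show ?thesis using layer_coherent_descend_step less.prems less.hyps by blast
  next
    case 3
    then have "layer_coherent b a (Suc m') n (rev q)" using less.prems ear_coherent_rev by blast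
    then obtain d c q' where "d + c < Suc m' + n" "layer_coherent b a d c q'"
      using layer_coherent_descend_step by blast
    then have "c + d < n + m" "layer_coherent a b c d (rev q')"
      using 3 ear_coherent_rev by simp_all
    then show ?thesis using less.hyps by blast
  qed
qed

subsection \<open>Coherence and ear coherence\<close>

lemma ear_separated_if_excursion:
  assumes p: "p \<in> ears H q" and q: "q = xs @ p @ zs" and open_ear: "hd p \<noteq> last p"
    and rt: "r \<le> length xs" "length xs < t" "q ! t \<in> set H"
    and exc: "admissible V E H f (q ! r) (q ! t) (take (Suc (t - r)) (drop r q))"
    and sep: "\<not> {q ! r, q ! t} \<subseteq> X" "\<not> {q ! r, q ! t} \<subseteq> Y"
  shows "separated X Y p"
proof -
  let ?d = "take (Suc (t - r)) (drop r q)"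
  obtain u ys v where p_eq: "p = u # ys @ [v]" using p by (rule ear_shape)
  have t: "length xs + length p \<le> Suc t"
  proof (rule ccontr)
    assume "\<not> ?thesis"
    then have h: "t - length xs - 1 < length ys" "t = length xs + Suc (t - length xs - 1)"
      using rt(2) by (simp_all add: p_eq)
    then have "q ! t = ys ! (t - length xs - 1)"
      by (subst h(2)) (simp add: q p_eq nth_append)
    then have "q ! t \<in> set (interior p)" using h(1) by (simp add: p_eq)
    then show False using rt(3) ear_interior[OF p] by blast
  qed
  have "?d = drop r xs @ p @ take (Suc t - length xs - length p) zs"
    using rt(1,2) t by (simp add: q)
  then have sub: "sublist p ?d" by (metis sublist_appendI)
  have d: "edges_of ?d \<subseteq> free_edges" "set ?d \<inter> set H \<subseteq> {q ! r, q ! t}"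
    using exc by (simp_all add: admissible_def trail_def walk_def)
  have "f \<notin> edges_of p" using edges_of_sublist[OF sub] d(1) by blast
  moreover have "{hd p, last p} \<subseteq> {q ! r, q ! t}"
    using set_mono_sublist[OF sub] ear_ends[OF p] d(2) by (auto simp: p_eq)
  then have "{hd p, last p} = {q ! r, q ! t}" using open_ear by auto
  ultimately show ?thesis using sep by (simp add: separated_def)
qed

lemma ear_coherent_if_coherent:
  assumes f: "f = e (Suc k)" and coh: "coherent V E k e a b Hs H n m q"
  shows "\<exists>q'. layer_coherent a b n m q'"
proof (rule excise_closed_ears)
  let ?X = "Layer a (Suc n)" and ?Y = "Layer b (Suc m)"
  note coh' = coh[unfolded coherent_def Let_def, folded f Suc_eq_plus1]
  show tr: "trail V E q" using coh' by blast
  then have q_ne: "q \<noteq> []" by (auto simp: trail_def walk_def)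
  show "e ` {1..k} \<subseteq> edges_of q" using coh' by blast
  show "hd q \<in> ?X" "last q \<in> ?Y"
    using coh' q_ne by (simp_all add: hd_conv_nth last_conv_nth del: layer.simps)
  show "\<forall>j\<in>{1..k}. traverses q (cl_seg (Hs j) (Layer a n)) \<and>
      traverses q (cl_seg (Hs j) (Layer b m))"
    using coh' subtrail_at_imp_traverses by meson
  show "\<forall>p\<in>ears H q. hd p \<noteq> last p \<longrightarrow> separated ?X ?Y p"
  proof (intro ballI impI)
    fix p assume p: "p \<in> ears H q" and open_ear: "hd p \<noteq> last p"
    obtain u x ys where p_eq: "p = u # x # ys"
      using p by (rule ear_shape) (metis append_Cons append_Nil list.exhaust)
    obtain xs zs where q: "q = xs @ p @ zs" using sublist_ear[OF p] by (auto simp: sublist_def)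
    let ?s = "Suc (length xs)"
    have edge: "{q ! (?s - 1), q ! ?s} = {u, x}" by (simp add: q p_eq nth_append)
    have "{u, x} \<in> edges_of p" by (simp add: p_eq)
    then have "{u, x} \<in> E - edges_of H"
      using edges_of_sublist[OF sublist_ear[OF p]] ear_edges_disjoint[OF p] tr
      unfolding trail_def walk_def by blast
    moreover have "?s \<in> {1..length q - 1}" by (simp add: q p_eq)
    ultimately obtain r t where "r < ?s" "?s \<le> t" "t \<le> length q - 1" "q ! t \<in> set H"
      "admissible V E H f (q ! r) (q ! t) (take (Suc (t - r)) (drop r q))"
      "\<not> (q ! r \<in> ?X \<and> q ! t \<in> ?X)" "\<not> (q ! r \<in> ?Y \<and> q ! t \<in> ?Y)"
      using coh' edge by metis
    then show "separated ?X ?Y p"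
      using ear_separated_if_excursion[OF p q open_ear, of r t ?X ?Y] by auto
  qed
qed

lemma coherent_if_ear_coherent:
  assumes f: "f = e (Suc k)" and coh: "layer_coherent a b 0 0 q"
  shows "coherent V E k e a b Hs H 0 0 q"
proof -
  let ?X = "Layer a (Suc 0)" and ?Y = "Layer b (Suc 0)"
  have tr: "trail V E q" and marked: "e ` {1..k} \<subseteq> edges_of q"
    and ends: "hd q \<in> ?X" "last q \<in> ?Y"
    and sep: "\<And>p. p \<in> ears H q \<Longrightarrow> separated ?X ?Y p"
    using coh by (simp_all add: ear_coherent_def del: layer.simps)
  have q_ne: "q \<noteq> []" using tr by (auto simp: trail_def walk_def)
  have endsH: "hd q \<in> set H" "last q \<in> set H" using ends Layer_subset_H by blast+
  have excursion: "\<exists>r t. r < s \<and> s \<le> t \<and> t \<le> length q - 1 \<and> q ! r \<in> set H \<and> q ! t \<in> set H \<and>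
        admissible V E H f (q ! r) (q ! t) (take (Suc (t - r)) (drop r q)) \<and>
        \<not> (q ! r \<in> ?X \<and> q ! t \<in> ?X) \<and> \<not> (q ! r \<in> ?Y \<and> q ! t \<in> ?Y)"
    if s: "s \<in> {1..length q - 1}" "{q ! (s - 1), q ! s} \<in> E - edges_of H" for s
  proof -
    have "0 < s" "s < length q" "{q ! (s - 1), q ! s} \<notin> edges_of H" using s by auto
    then obtain r t where bounds: "r < s" "s \<le> t" "t < length q"
      and ear: "take (Suc (t - r)) (drop r q) \<in> ears H q"
      and p: "hd (take (Suc (t - r)) (drop r q)) = q ! r"
        "last (take (Suc (t - r)) (drop r q)) = q ! t"
      using endsH by (rule ear_around_position)
    let ?p = "take (Suc (t - r)) (drop r q)"
    have "admissible V E H f (q ! r) (q ! t) ?p"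
      using ear_admissible[OF tr ear] sep[OF ear] p by (simp add: separated_def)
    then show ?thesis
      using bounds ear_ends[OF ear] sep[OF ear] p
      by (intro exI[of _ r] exI[of _ t]) (simp add: separated_def del: layer.simps)
  qed
  have "\<exists>IA IB :: nat \<Rightarrow> nat set.
      (\<forall>j\<in>{1..k}. subtrail_at (cl_seg (Hs j) (Layer a 0)) q (IA j) \<and>
                  subtrail_at (cl_seg (Hs j) (Layer b 0)) q (IB j)) \<and>
      (\<forall>j\<in>{1..k}. \<forall>j'\<in>{1..k}. j \<noteq> j' \<longrightarrow>
         (\<forall>I\<in>{IA, IB}. \<forall>J\<in>{IA, IB}. I j \<inter> J j' = {}))"
    by (intro exI[of _ "\<lambda>_. {}"]) (simp add: cl_seg_eq_Nil_iff subtrail_at_def)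
  moreover have "\<forall>i\<in>{1..k}. e i \<in> edges_of q" using marked by blast
  moreover have "q ! 0 \<in> ?X" "q ! (length q - 1) \<in> ?Y"
    using ends q_ne by (simp_all add: hd_conv_nth last_conv_nth del: layer.simps)
  ultimately show ?thesis
    unfolding coherent_def Let_def f[symmetric] add_0 One_nat_def
    using tr excursion by (simp only: One_nat_def) blast
qed

end

theorem theorem4p9:
  fixes V :: "'a set" and E :: "'a set set"
    and k :: nat and e :: "nat \<Rightarrow> 'a set" and a b :: 'a
    and H :: "'a list" and Hs :: "nat \<Rightarrow> 'a list"
    and n m :: nat
  assumes "simple_graph V E"
    and "edge_connected 2 V E"
    and "k \<ge> 1"
    and "\<forall>i\<in>{1..k + 1}. e i \<in> E"
    and "e (k + 1) = {a, b}"
    and "shortest_circuit_through V E (e ` {1..k}) H"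
    and "segmentation k e Hs H"
    and "\<exists>Q. coherent V E k e a b Hs H n m Q"
  shows "\<exists>Q. coherent V E k e a b Hs H 0 0 Q"
proof -
  interpret segmented_circuit V E k e Hs H "e (Suc k)"
    using assms by unfold_locales (simp_all add: shortest_circuit_through_def)
  obtain Q where "coherent V E k e a b Hs H n m Q" using assms(8) by blast
  then obtain q where "layer_coherent a b n m q" using ear_coherent_if_coherent[OF refl] by blast
  then obtain q' where "layer_coherent a b 0 0 q'" using layer_coherent_descend by blast
  then show ?thesis using coherent_if_ear_coherent[OF refl] by blast
qed

end
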